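(* Let $\varphi\in\mathcal I$ and let $\mu=\sum_{i=1}^m\lambda_i\delta_{u_i}$, where $\lambda_i>0$ for all $i$ and $\{u_1,\dots,u_m\}\subset S^{n-1}$ is not concentrated on any closed hemisphere. Let $G\in\mathcal G_I$ be a continuous function such that, for some $q\ge n-1$, $$\inf\Big\{\frac{G(t,u)}{t^q}:\ t\ge 1,\ u\in S^{n-1}\Big\}>0.$$ Then the following statements hold. i) There exists a polytope $\widetilde P\in\widetilde{\mathcal B}$, with $u_1,\dots,u_m$ being the corresponding unit normal vectors of its faces, such that $$\sum_{i=1}^m\lambda_i\varphi(h_{\widetilde P}(u_i))=\inf\Big\{\sum_{i=1}^m\lambda_i\varphi(h_Q(u_i)):\ Q\in\widetilde{\mathcal B}\Big\}.$$ ii) There exists a polytope $\widehat P\in\widehat{\mathcal B}$, with $u_1,\dots,u_m$ being the corresponding unit normal vectors of its faces, such that $$\sum_{i=1}^m\lambda_i\varphi(h_{\widehat P}(u_i))=\inf\Big\{\sum_{i=1}^m\lambda_i\varphi(h_Q(u_i)):\ Q\in\widehat{\mathcal B}\Big\}.$$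
   Context: Work in $\mathbb R^n$, $n\ge2$, with inner product $\langle\cdot,\cdot\rangle$, unit ball $B^n$ and unit sphere $S^{n-1}$; $du$ denotes the spherical measure on $S^{n-1}$ (the $(n-1)$-dimensional Hausdorff measure). $\mathcal K_{(o)}^n$ is the set of compact convex subsets of $\mathbb R^n$ with the origin $o$ in their interiors. For $K\in\mathcal K_{(o)}^n$ and $u\in S^{n-1}$: $h_K(u)=\max_{x\in K}\langle x,u\rangle$, $\rho_K(u)=\max\{\lambda\ge0:\lambda u\in K\}$, and $K^\circ=\{x\in\mathbb R^n:\langle x,y\rangle\le1\ \forall y\in K\}$. $\mathcal I$ is the set of continuous strictly increasing functions $\varphi:(0,\infty)\to(0,\infty)$ with $\lim_{t\to0^+}\varphi(t)=0$, $\varphi(1)=1$, $\lim_{t\to\infty}\varphi(t)=\infty$. $\mathcal G_I$ is the set of continuous $G:(0,\infty)\times S^{n-1}\to(0,\infty)$ such that for each $u\in S^{n-1}$, $t\mapsto G(t,u)$ is strictly increasing with $\lim_{t\to0^+}G(t,u)=0$ and $\lim_{t\to\infty}G(t,u)=\infty$. The general dual volume is $\widetilde V_G(K)=\int_{S^{n-1}}G(\rho_K(u),u)\,du$ for $K\in\mathcal K_{(o)}^n$. For $G\in\mathcal G_I$ the homogeneous general dual volume is $\widehat V_G(K)=\inf\{\eta>0:\int_{S^{n-1}}G(\rho_K(u)/\eta,u)\,du\le1\}$. Set $$\widetilde{\mathcal B}=\{Q\in\mathcal K_{(o)}^n:\widetilde V_G(Q^\circ)=\widetilde V_G(B^n)\},\qquad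 \widehat{\mathcal B}=\{Q\in\mathcal K_{(o)}^n:\widehat V_G(Q^\circ)=\widehat V_G(B^n)\}.$$ $\delta_{u}$ is the Dirac measure at $u$. The set $\{u_1,\dots,u_m\}$ is not concentrated on any closed hemisphere if for every $v\in S^{n-1}$ there is $i$ with $\langle u_i,v\rangle>0$. A polytope $P\in\mathcal K^n_{(o)}$ has $u_1,\dots,u_m$ as the corresponding unit normal vectors of its faces if $P=\bigcap_{i=1}^m\{x\in\mathbb R^n:\langle x,u_i\rangle\le h_P(u_i)\}$. *)

theory Defs
  imports "HOL-Analysis.Analysis"
begin

section \<open>Hausdorff measure and the spherical measure\<close>

text \<open>
  The empty set gets size 0 separately because \<open>0 ^ 0 = 1\<close>; with this convention
  the 0-dimensional measure is the counting measure. The factor \<open>unit_ball_vol k / 2 ^ k\<close> is the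
  normalisation for which the k-dimensional Hausdorff measure is the usual k-dimensional volume.
\<close>
definition hausdorff_gauge :: "nat \<Rightarrow> 'a::metric_space set \<Rightarrow> ennreal" where
  "hausdorff_gauge k A =
     (if A = {} then 0 else ennreal (unit_ball_vol (real k) * (diameter A / 2) ^ k))"

text \<open>Boundedness is required explicitly since \<open>diameter\<close> is unspecified on unbounded sets.\<close>
definition hausdorff_content :: "nat \<Rightarrow> real \<Rightarrow> 'a::metric_space set \<Rightarrow> ennreal" where
  "hausdorff_content k \<delta> A =
     (INF C \<in> {C :: nat \<Rightarrow> 'a set. A \<subseteq> (\<Union>i. C i) \<and> (\<forall>i. bounded (C i) \<and> diameter (C i) \<le> \<delta>)}.
        \<Sum>i. hausdorff_gauge k (C i))"

definition hausdorff_outer :: "nat \<Rightarrow> 'a::metric_space set \<Rightarrow> ennreal" where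
  "hausdorff_outer k A = (SUP \<delta>\<in>{0<..}. hausdorff_content k \<delta> A)"

text \<open>
  \<open>measure_of\<close> would return the null measure if \<open>hausdorff_outer k\<close> were not countably additive on
  the Borel sets; the lemma \<open>emeasure_hausdorff_measure\<close> below shows that it is.
\<close>
definition hausdorff_measure :: "nat \<Rightarrow> 'a::metric_space measure" where
  "hausdorff_measure k = measure_of UNIV (sets borel) (hausdorff_outer k)"

definition spherical_measure :: "'a::euclidean_space measure" where
  "spherical_measure = restrict_space (hausdorff_measure (DIM('a) - 1)) (sphere 0 1)"

lemma hausdorff_content_le:
  assumes "A \<subseteq> (\<Union>i. C i)" "\<And>i. bounded (C i)" "\<And>i. diameter (C i) \<le> \<delta>"
  shows "hausdorff_content k \<delta> A \<le> (\<Sum>i. hausdorff_gauge k (C i))"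
  unfolding hausdorff_content_def by (rule INF_lower) (use assms in auto)

lemma hausdorff_content_mono: "A \<subseteq> B \<Longrightarrow> hausdorff_content k \<delta> A \<le> hausdorff_content k \<delta> B"
  unfolding hausdorff_content_def by (rule INF_superset_mono) auto

lemma hausdorff_content_antimono:
  "\<delta> \<le> \<delta>' \<Longrightarrow> hausdorff_content k \<delta>' A \<le> hausdorff_content k \<delta> A"
  unfolding hausdorff_content_def by (rule INF_superset_mono) (auto intro: order_trans)

lemma hausdorff_content_le_outer: "\<delta> > 0 \<Longrightarrow> hausdorff_content k \<delta> A \<le> hausdorff_outer k A"
  unfolding hausdorff_outer_def by (rule SUP_upper) auto

lemma hausdorff_outer_mono: "A \<subseteq> B \<Longrightarrow> hausdorff_outer k A \<le> hausdorff_outer k B"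
  unfolding hausdorff_outer_def by (rule SUP_mono') (rule hausdorff_content_mono)

lemma hausdorff_outer_empty [simp]: "hausdorff_outer k {} = 0"
proof -
  have "hausdorff_content k \<delta> {} = 0" if "\<delta> > 0" for \<delta>
    using hausdorff_content_le[of "{}" "\<lambda>_. {}" \<delta> k] that by (simp add: hausdorff_gauge_def)
  then show ?thesis
    unfolding hausdorff_outer_def by (intro antisym SUP_least) auto
qed

lemma hausdorff_content_subadditive:
  "hausdorff_content k \<delta> (\<Union>n::nat. A n) \<le> (\<Sum>n. hausdorff_content k \<delta> (A n))"
proof (rule ennreal_le_epsilon)
  fix e :: real
  assume e: "0 < e" and fin: "(\<Sum>n. hausdorff_content k \<delta> (A n)) < top"
  let ?c = "hausdorff_content k \<delta>"
  have *: "?c (A n) < ?c (A n) + e * (1/2) ^ Suc n" for n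
    using e fin by (auto simp add: less_top dest!: ennreal_suminf_lessD)
  have "\<exists>C. A n \<subseteq> (\<Union>i. C i) \<and> (\<forall>i::nat. bounded (C i) \<and> diameter (C i) \<le> \<delta>) \<and>
          (\<Sum>i. hausdorff_gauge k (C i)) < ?c (A n) + e * (1/2) ^ Suc n" for n
    using *[of n] unfolding hausdorff_content_def[of k \<delta> "A n"] INF_less_iff by auto
  then obtain B where B: "\<And>n. A n \<subseteq> (\<Union>i::nat. B n i)"
    and Bb: "\<And>n i. bounded (B n i) \<and> diameter (B n i) \<le> \<delta>"
    and Bs: "\<And>n. (\<Sum>i. hausdorff_gauge k (B n i)) < ?c (A n) + e * (1/2) ^ Suc n"
    by metis
  define C where "C = case_prod B o prod_decode"
  have "(\<Union>n. A n) \<subseteq> (\<Union>i. C i)"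
    using B by (auto simp add: C_def subset_eq) (metis prod.case prod_encode_inverse)
  then have "?c (\<Union>n. A n) \<le> (\<Sum>i. hausdorff_gauge k (C i))"
    by (rule hausdorff_content_le) (use Bb in \<open>auto simp: C_def split_def\<close>)
  also have "\<dots> = (\<Sum>n. \<Sum>i. hausdorff_gauge k (B n i))"
    unfolding C_def comp_def by (intro suminf_ennreal_2dimen) auto
  also have "\<dots> \<le> (\<Sum>n. ?c (A n) + e * (1/2) ^ Suc n)"
    using Bs by (intro suminf_le allI less_imp_le) auto
  also have "\<dots> = (\<Sum>n. ?c (A n)) + (\<Sum>n. ennreal e * ennreal ((1/2) ^ Suc n))"
    using e by (subst suminf_add[symmetric])
               (auto simp del: ennreal_suminf_cmult simp add: ennreal_mult[symmetric])
  also have "\<dots> = (\<Sum>n. ?c (A n)) + e"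
    unfolding ennreal_suminf_cmult
    by (subst suminf_ennreal_eq[OF zero_le_power power_half_series]) auto
  finally show "?c (\<Union>n. A n) \<le> (\<Sum>n. ?c (A n)) + e" .
qed

lemma hausdorff_outer_subadditive:
  "hausdorff_outer k (\<Union>n::nat. A n) \<le> (\<Sum>n. hausdorff_outer k (A n))"
  unfolding hausdorff_outer_def[of k "\<Union>n. A n"]
proof (rule SUP_least)
  fix \<delta> :: real assume "\<delta> \<in> {0<..}"
  then have "(\<Sum>n. hausdorff_content k \<delta> (A n)) \<le> (\<Sum>n. hausdorff_outer k (A n))"
    by (intro suminf_le) (auto intro: hausdorff_content_le_outer)
  with hausdorff_content_subadditive show
    "hausdorff_content k \<delta> (\<Union>n. A n) \<le> (\<Sum>n. hausdorff_outer k (A n))"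
    by (rule order_trans)
qed

lemma outer_measure_space_hausdorff_outer:
  "outer_measure_space (Pow UNIV) (hausdorff_outer k)"
  by (auto simp: outer_measure_space_def positive_def increasing_def countably_subadditive_def
      hausdorff_outer_mono hausdorff_outer_subadditive)

lemma hausdorff_outer_Un:
  "hausdorff_outer k (A \<union> B) \<le> hausdorff_outer k A + hausdorff_outer k B"
proof -
  have "subadditive (Pow UNIV) (hausdorff_outer k)"
    using outer_measure_space_hausdorff_outer[of k]
    by (intro ring_of_sets.countably_subadditive_subadditive[OF ring_of_sets_Pow])
       (auto simp: outer_measure_space_def)
  then have "hausdorff_outer k (A \<union> (B - A)) \<le> hausdorff_outer k A + hausdorff_outer k (B - A)"
    by (rule subadditiveD) auto
  also have "\<dots> \<le> hausdorff_outer k A + hausdorff_outer k B"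
    by (intro add_left_mono hausdorff_outer_mono) auto
  finally show ?thesis by simp
qed

lemma hausdorff_outer_separated:
  assumes e: "e > 0" and sep: "\<And>x y. x \<in> A \<Longrightarrow> y \<in> B \<Longrightarrow> dist x y \<ge> e"
  shows "hausdorff_outer k A + hausdorff_outer k B \<le> hausdorff_outer k (A \<union> B)"
proof -
  have *: "hausdorff_content k d A + hausdorff_content k d' B \<le> hausdorff_outer k (A \<union> B)"
    if d: "d > 0" "d' > 0" for d d'
  proof -
    define m where "m = min (min d d') (e / 2)"
    have m: "m > 0" "m \<le> d" "m \<le> d'" "m < e"
      using d e by (auto simp: m_def)
    have "hausdorff_content k m A + hausdorff_content k m B \<le> hausdorff_content k m (A \<union> B)"
      unfolding hausdorff_content_def[of k m "A \<union> B"]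
    proof (rule INF_greatest, clarify)
      fix C :: "nat \<Rightarrow> 'a set"
      assume C: "A \<union> B \<subseteq> (\<Union>i. C i)" "\<forall>i. bounded (C i) \<and> diameter (C i) \<le> m"
      define CA where "CA = (\<lambda>i. if C i \<inter> A = {} then {} else C i)"
      define CB where "CB = (\<lambda>i. if C i \<inter> B = {} then {} else C i)"
      have "hausdorff_content k m A \<le> (\<Sum>i. hausdorff_gauge k (CA i))"
        by (rule hausdorff_content_le) (use C m in \<open>fastforce simp: CA_def split: if_splits\<close>)+
      moreover have "hausdorff_content k m B \<le> (\<Sum>i. hausdorff_gauge k (CB i))"
        by (rule hausdorff_content_le) (use C m in \<open>fastforce simp: CB_def split: if_splits\<close>)+
      moreover have "hausdorff_gauge k (CA i) + hausdorff_gauge k (CB i) \<le> hausdorff_gauge k (C i)" for i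
      proof (cases "C i \<inter> A = {} \<or> C i \<inter> B = {}")
        case True
        then show ?thesis by (auto simp: CA_def CB_def hausdorff_gauge_def)
      next
        case False
        then obtain x y where xy: "x \<in> C i" "x \<in> A" "y \<in> C i" "y \<in> B" by auto
        then have "dist x y \<le> m"
          using C(2) diameter_bounded_bound[of "C i" x y] by (meson order_trans)
        with sep[of x y] xy m show ?thesis by simp
      qed
      then have "(\<Sum>i. hausdorff_gauge k (CA i)) + (\<Sum>i. hausdorff_gauge k (CB i))
                   \<le> (\<Sum>i. hausdorff_gauge k (C i))"
        by (subst suminf_add) (auto intro!: suminf_le)
      ultimately show "hausdorff_content k m A + hausdorff_content k m B
                         \<le> (\<Sum>i. hausdorff_gauge k (C i))"
        by (meson add_mono order_trans)
    qed
    with m show ?thesis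
      by (meson add_mono order_trans hausdorff_content_antimono hausdorff_content_le_outer)
  qed
  have ne: "{0::real<..} \<noteq> {}" by (metis greaterThan_non_empty)
  have "hausdorff_content k d A + hausdorff_outer k B \<le> hausdorff_outer k (A \<union> B)" if "d > 0" for d
    unfolding hausdorff_outer_def[of k B] ennreal_SUP_add_right[OF ne]
    by (rule SUP_least) (use * that in auto)
  then have "(SUP d\<in>{0<..}. hausdorff_content k d A + hausdorff_outer k B) \<le> hausdorff_outer k (A \<union> B)"
    by (intro SUP_least) auto
  then show ?thesis
    unfolding hausdorff_outer_def[of k A] by (simp add: ennreal_SUP_add_left[OF ne])
qed

lemma hausdorff_outer_closed_split:
  fixes F :: "'a::metric_space set"
  assumes F: "closed F"
  shows "hausdorff_outer k (T \<inter> F) + hausdorff_outer k (T - F) \<le> hausdorff_outer k T"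
proof (cases "F = {} \<or> hausdorff_outer k T = top")
  case True
  then show ?thesis by auto
next
  case False
  let ?H = "hausdorff_outer k :: 'a set \<Rightarrow> ennreal"
  have ne: "F \<noteq> {}" and fin: "?H T < top"
    using False by (auto simp: less_top)
  define U where "U = (\<lambda>n::nat. {x \<in> T. infdist x F \<ge> 1 / (real n + 1)})"
  define R where "R = (\<lambda>n. U (Suc n) - U n)"
  have Rlow: "1 / real m \<le> infdist x F" if "x \<in> R i" "i + 2 \<le> m" for x i m
  proof -
    have "1 / real m \<le> 1 / (real (Suc i) + 1)"
      using that(2) by (intro divide_left_mono) auto
    also have "\<dots> \<le> infdist x F" using that(1) by (auto simp: R_def U_def)
    finally show ?thesis .
  qed
  have Rup: "infdist x F < 1 / (real m + 1)" if "x \<in> R m" for x m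
    using that by (auto simp: R_def U_def)
  have RT: "R n \<subseteq> T" for n by (auto simp: R_def U_def)
  have part: "(\<Sum>j<n. ?H (R (2 * j + c))) \<le> ?H (\<Union>j<n. R (2 * j + c))" for n c
  proof (induction n)
    case (Suc n)
    show ?case
    proof (cases "n = 0")
      case True
      then show ?thesis by (simp add: lessThan_Suc)
    next
      case n: False
      define m where "m = 2 * n + c"
      have m: "real m > 0" using n by (simp add: m_def)
      have "?H (\<Union>j<n. R (2 * j + c)) + ?H (R m) \<le> ?H ((\<Union>j<n. R (2 * j + c)) \<union> R m)"
      proof (rule hausdorff_outer_separated[of "1 / real m - 1 / (real m + 1)"])
        show "0 < 1 / real m - 1 / (real m + 1)"
          using m by (simp add: divide_simps)
        fix x y assume "x \<in> (\<Union>j<n. R (2 * j + c))" and y: "y \<in> R m"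
        then obtain j where j: "j < n" "x \<in> R (2 * j + c)" by auto
        have "1 / real m \<le> infdist x F"
          by (rule Rlow[OF j(2)]) (use j(1) in \<open>simp add: m_def\<close>)
        with Rup[OF y] infdist_triangle[of x F y]
        show "1 / real m - 1 / (real m + 1) \<le> dist x y" by linarith
      qed
      with Suc.IH have "(\<Sum>j<Suc n. ?H (R (2 * j + c))) \<le> ?H ((\<Union>j<n. R (2 * j + c)) \<union> R m)"
        by (auto simp: m_def intro: order_trans add_right_mono)
      also have "(\<Union>j<n. R (2 * j + c)) \<union> R m = (\<Union>j<Suc n. R (2 * j + c))"
        by (auto simp: m_def lessThan_Suc)
      finally show ?thesis .
    qed
  qed simp
  have partT: "(\<Sum>j<n. ?H (R (2 * j + c))) \<le> ?H T" for n c
    by (rule order_trans[OF part hausdorff_outer_mono]) (use RT in auto)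
  have even_odd: "(\<Sum>j<2 * n. f j) = (\<Sum>j<n. f (2 * j + 0)) + (\<Sum>j<n. f (2 * j + 1))"
    for n :: nat and f :: "nat \<Rightarrow> ennreal"
    by (induction n) (auto simp: ac_simps)
  have "(\<Sum>j<n. ?H (R j)) \<le> ?H T + ?H T" for n
  proof -
    have "(\<Sum>j<n. ?H (R j)) \<le> (\<Sum>j<2 * n. ?H (R j))"
      by (rule sum_mono2) auto
    also have "\<dots> \<le> ?H T + ?H T"
      unfolding even_odd by (rule add_mono[OF partT partT])
    finally show ?thesis .
  qed
  then have "(\<Sum>j. ?H (R j)) \<le> ?H T + ?H T"
    by (intro suminf_le_const[OF summableI])
  also have "\<dots> < top" using fin by (simp add: less_top)
  finally have Rfin: "(\<Sum>j. ?H (R j)) < top" .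
  define r where "r = (\<lambda>j. enn2real (?H (R j)))"
  have Rr: "?H (R j) = ennreal (r j)" for j
    using ennreal_suminf_lessD[OF Rfin, of j] by (simp add: r_def)
  have r0: "r j \<ge> 0" for j by (simp add: r_def)
  have rsum: "summable r"
    by (rule summable_suminf_not_top) (use r0 Rfin in \<open>auto simp: Rr\<close>)
  show ?thesis
  proof (rule ennreal_le_epsilon)
    fix e :: real assume e: "0 < e"
    obtain K where "\<And>n. n \<ge> K \<Longrightarrow> norm (\<Sum>i. r (i + n)) < e"
      using suminf_exist_split[OF e rsum] by auto
    then have "(\<Sum>i. r (i + K)) \<le> e" by force
    then have tail: "(\<Sum>i. ?H (R (i + K))) \<le> ennreal e"
      unfolding Rr using rsum r0
      by (subst suminf_ennreal2) (auto simp: summable_iff_shift intro: ennreal_leI)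
    have "T - F \<subseteq> U K \<union> (\<Union>i. R (i + K))"
    proof
      fix x assume x: "x \<in> T - F"
      then have "infdist x F > 0"
        using F ne infdist_pos_not_in_closed by fastforce
      then obtain n where "inverse (real (Suc n)) < infdist x F"
        using reals_Archimedean by blast
      with x have ex: "x \<in> U n" by (auto simp: U_def inverse_eq_divide add.commute)
      have "x \<in> U i \<Longrightarrow> x \<in> U K \<union> (\<Union>i. R (i + K))" for i
      proof (induction i)
        case 0
        then have 1: "1 \<le> infdist x F" "x \<in> T" by (auto simp: U_def)
        have "1 / (real K + 1) \<le> infdist x F"
          by (rule order_trans[OF _ 1(1)]) simp
        with 1(2) have "x \<in> U K" by (simp add: U_def)
        then show ?case by simp
      next
        case (Suc i)
        consider "x \<in> U i" | "x \<in> R i" "K \<le> i" | "x \<in> R i" "i < K"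
          using Suc.prems le_less_linear[of K i] unfolding R_def by blast
        then show ?case
        proof cases
          case 1 then show ?thesis by (rule Suc.IH)
        next
          case 2
          then have "x \<in> R ((i - K) + K)" by simp
          then show ?thesis by blast
        next
          case 3
          then have "1 / (real K + 1) \<le> 1 / (real (Suc i) + 1)"
            by (intro divide_left_mono) auto
          with Suc.prems have "x \<in> U K" unfolding U_def by (auto intro: order_trans)
          then show ?thesis by simp
        qed
      qed
      from this[OF ex] show "x \<in> U K \<union> (\<Union>i. R (i + K))" .
    qed
    then have "?H (T - F) \<le> ?H (U K \<union> (\<Union>i. R (i + K)))"
      by (rule hausdorff_outer_mono)
    also have "\<dots> \<le> ?H (U K) + ?H (\<Union>i. R (i + K))"
      by (rule hausdorff_outer_Un)
    also have "\<dots> \<le> ?H (U K) + ennreal e"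
      by (intro add_left_mono order_trans[OF hausdorff_outer_subadditive tail])
    finally have "?H (T \<inter> F) + ?H (T - F) \<le> (?H (T \<inter> F) + ?H (U K)) + ennreal e"
      by (simp add: add.assoc add_left_mono)
    also have "?H (T \<inter> F) + ?H (U K) \<le> ?H ((T \<inter> F) \<union> U K)"
    proof (rule hausdorff_outer_separated[of "1 / (real K + 1)"])
      fix x y assume "x \<in> T \<inter> F" "y \<in> U K"
      then show "1 / (real K + 1) \<le> dist x y"
        using infdist_le[of x F y] by (auto simp: U_def dist_commute)
    qed simp
    also have "?H ((T \<inter> F) \<union> U K) \<le> ?H T"
      by (rule hausdorff_outer_mono) (auto simp: U_def)
    finally show "?H (T \<inter> F) + ?H (T - F) \<le> ?H T + ennreal e"
      by (simp add: add_right_mono)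
  qed
qed

lemma measure_space_hausdorff_outer:
  "measure_space UNIV (sets borel) (hausdorff_outer k :: 'a::metric_space set \<Rightarrow> ennreal)"
proof -
  let ?L = "lambda_system UNIV (Pow UNIV) (hausdorff_outer k :: 'a set \<Rightarrow> ennreal)"
  have ms: "measure_space UNIV ?L (hausdorff_outer k)"
    by (rule sigma_algebra.caratheodory_lemma[OF sigma_algebra_Pow
          outer_measure_space_hausdorff_outer])
  then interpret L: sigma_algebra UNIV ?L by (simp add: measure_space_def)
  have closed: "F \<in> ?L" if "closed F" for F
  proof -
    have "hausdorff_outer k (F \<inter> T) + hausdorff_outer k ((UNIV - F) \<inter> T) = hausdorff_outer k T" for T
    proof (rule antisym)
      have "F \<inter> T = T \<inter> F" "(UNIV - F) \<inter> T = T - F" by auto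
      with hausdorff_outer_closed_split[OF that, of k T] show
        "hausdorff_outer k (F \<inter> T) + hausdorff_outer k ((UNIV - F) \<inter> T) \<le> hausdorff_outer k T"
        by simp
      have "F \<inter> T \<union> (UNIV - F) \<inter> T = T" by auto
      with hausdorff_outer_Un[of k "F \<inter> T" "(UNIV - F) \<inter> T"] show
        "hausdorff_outer k T \<le> hausdorff_outer k (F \<inter> T) + hausdorff_outer k ((UNIV - F) \<inter> T)"
        by simp
    qed
    then show ?thesis by (simp add: lambda_system_def)
  qed
  have "sets (borel :: 'a measure) \<subseteq> ?L"
    unfolding borel_eq_closed using L.sigma_sets_subset[of "Collect closed"] closed by auto
  then show ?thesis
    using measure_down[OF ms] sets.sigma_algebra_axioms[of "borel :: 'a measure"] by simp
qed

lemma sets_hausdorff_measure [simp, measurable_cong]: "sets (hausdorff_measure k) = sets borel"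
  unfolding hausdorff_measure_def using sets.sigma_sets_eq[of borel] by simp

lemma space_hausdorff_measure [simp]: "space (hausdorff_measure k) = UNIV"
  by (simp add: hausdorff_measure_def)

lemma emeasure_hausdorff_measure:
  assumes "A \<in> sets borel"
  shows "emeasure (hausdorff_measure k) A = hausdorff_outer k A"
  unfolding hausdorff_measure_def
  using measure_space_hausdorff_outer[of k] assms sets.sigma_sets_eq[of borel]
  by (subst emeasure_measure_of_sigma) (auto simp: measure_space_def sets.sigma_algebra_axioms)


section \<open>Convex bodies\<close>

definition convex_bodies :: "'a::euclidean_space set set" where
  "convex_bodies = {K. compact K \<and> convex K \<and> 0 \<in> interior K}"

definition support_fun :: "'a::euclidean_space set \<Rightarrow> 'a \<Rightarrow> real" where
  "support_fun K u = (SUP x\<in>K. x \<bullet> u)"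

definition radial_fun :: "'a::euclidean_space set \<Rightarrow> 'a \<Rightarrow> real" where
  "radial_fun K u = Sup {c. c \<ge> 0 \<and> c *\<^sub>R u \<in> K}"

definition polar_body :: "'a::euclidean_space set \<Rightarrow> 'a set" where
  "polar_body K = {x. \<forall>y\<in>K. x \<bullet> y \<le> 1}"

definition not_in_closed_hemisphere :: "'a::euclidean_space set \<Rightarrow> bool" where
  "not_in_closed_hemisphere U \<longleftrightarrow> (\<forall>v\<in>sphere 0 1. \<exists>u\<in>U. u \<bullet> v > 0)"

definition has_face_normals :: "'a::euclidean_space set \<Rightarrow> 'a set \<Rightarrow> bool" where
  "has_face_normals P U \<longleftrightarrow> P = (\<Inter>u\<in>U. {x. x \<bullet> u \<le> support_fun P u})"


section \<open>The function classes and the general dual volumes\<close>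

text \<open>Functions on \<open>(0,\<infinity>)\<close> are represented by functions on the reals whose values outside
  \<open>{0<..}\<close> are irrelevant, and similarly for functions on \<open>(0,\<infinity>) \<times> S\<close>, \<open>S\<close> the unit sphere.\<close>

definition class_I :: "(real \<Rightarrow> real) set" where
  "class_I = {\<phi>. continuous_on {0<..} \<phi> \<and> (\<forall>t>0. \<phi> t > 0) \<and> strict_mono_on {0<..} \<phi> \<and>
     (\<phi> \<longlongrightarrow> 0) (at_right 0) \<and> \<phi> 1 = 1 \<and> filterlim \<phi> at_top at_top}"

definition class_G_I :: "(real \<Rightarrow> 'a::euclidean_space \<Rightarrow> real) set" where
  "class_G_I = {G. continuous_on ({0<..} \<times> sphere 0 1) (\<lambda>(t, u). G t u) \<and>
     (\<forall>t>0. \<forall>u\<in>sphere 0 1. G t u > 0) \<and>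
     (\<forall>u\<in>sphere 0 1. strict_mono_on {0<..} (\<lambda>t. G t u) \<and>
        ((\<lambda>t. G t u) \<longlongrightarrow> 0) (at_right 0) \<and> filterlim (\<lambda>t. G t u) at_top at_top)}"

text \<open>For \<open>G \<in> class_G_I\<close> and a convex body \<open>K\<close> both integrands below are positive and continuous on
  the unit sphere, so the convention that non-integrable functions have integral 0 does not
  intervene.\<close>
definition dual_vol :: "(real \<Rightarrow> 'a::euclidean_space \<Rightarrow> real) \<Rightarrow> 'a set \<Rightarrow> real" where
  "dual_vol G K = (\<integral>u. G (radial_fun K u) u \<partial>spherical_measure)"

definition hom_dual_vol :: "(real \<Rightarrow> 'a::euclidean_space \<Rightarrow> real) \<Rightarrow> 'a set \<Rightarrow> real" where
  "hom_dual_vol G K =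
     Inf {\<eta>. \<eta> > 0 \<and> (\<integral>u. G (radial_fun K u / \<eta>) u \<partial>spherical_measure) \<le> 1}"

definition B_tilde :: "(real \<Rightarrow> 'a::euclidean_space \<Rightarrow> real) \<Rightarrow> 'a set set" where
  "B_tilde G = {Q \<in> convex_bodies. dual_vol G (polar_body Q) = dual_vol G (cball 0 1)}"

definition B_hat :: "(real \<Rightarrow> 'a::euclidean_space \<Rightarrow> real) \<Rightarrow> 'a set set" where
  "B_hat G = {Q \<in> convex_bodies. hom_dual_vol G (polar_body Q) = hom_dual_vol G (cball 0 1)}"

end

theory Submission
  imports Defs
begin

text \<open>
  For \<open>Q\<close> in the constraint class, the polytope \<open>P\<close> cut out by the supporting halfspaces of \<open>Q\<close> with
  normals \<open>u\<^sub>i\<close> contains \<open>Q\<close> and has the same objective value, while its polar has smaller dual volume.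
  So the objective may be minimised over support vectors \<open>z\<close> with the constraint relaxed to
  "dual volume of the polar at most that of the ball". Minimising sequences are bounded because
  \<open>\<phi>\<close> tends to infinity, and bounded away from 0 because \<open>z\<^sub>i \<longrightarrow> 0\<close> would produce a long spike of
  the polar body in direction \<open>u\<^sub>i\<close>, whose dual volume is infinite in the limit as \<open>q \<ge> n - 1\<close>. At a
  minimiser the relaxed constraint is tight, since otherwise shrinking \<open>z\<close> would decrease the objective.
  The homogeneous case reduces to the first one by rescaling the first argument of \<open>G\<close> by
  the homogeneous dual volume of the ball.
\<close>

section \<open>The spherical measure of caps and of the sphere\<close>

text \<open>The exponent \<open>n - 1\<close> is borderline: the (1-n)-th power of the distance to
  \<open>u\<close> just fails to be integrable on the sphere, with only logarithmic divergence. The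
  estimates therefore rest on a lower bound for the measure of a cap of radius \<open>s\<close> with
  exactly the power \<open>s ^ (n-1)\<close>, and on finiteness of the total measure. Both come from
  the covering definition of Hausdorff measure by comparing volumes in the ambient space. The spike
  has a simple origin. The radial function of a polar is the reciprocal of the support function, and
  the support function at \<open>v\<close> is at most its bound at \<open>u i\<close> plus a
  constant times the distance from \<open>v\<close> to \<open>u i\<close>. Polytopes are
  parametrised by a vector \<open>z\<close> that need not consist of their support numbers, so the
  minimisation takes place over finitely many real coordinates, where bounded sequences have
  convergent subsequences. Growth of \<open>G\<close> is assumed from an arbitrary threshold
  \<open>T\<close> on, because rescaling the first argument moves the threshold.\<close>

lemma space_spherical_measure [simp]: "space (spherical_measure :: 'a::euclidean_space measure) = sphere 0 1"
  by (simp add: spherical_measure_def space_restrict_space)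

lemma sets_spherical_measure [measurable_cong]:
  "sets (spherical_measure :: 'a::euclidean_space measure) = sets (restrict_space borel (sphere 0 1))"
  unfolding spherical_measure_def by (rule sets_restrict_space_cong) simp

lemma emeasure_spherical_measure:
  assumes "A \<in> sets borel" "A \<subseteq> sphere 0 1"
  shows "emeasure spherical_measure (A :: 'a::euclidean_space set) = hausdorff_outer (DIM('a) - 1) A"
  unfolding spherical_measure_def using assms
  by (subst emeasure_restrict_space) (auto simp: emeasure_hausdorff_measure)

text \<open>Spherical sets are measured by the Lebesgue measure of their radial thickening between the radii
  \<open>1\<close> and \<open>1 + s\<close>.\<close>

lemma radial_thickening_cover:
  fixes C :: "'a::euclidean_space set"
  assumes C: "\<And>x y. x \<in> C \<Longrightarrow> y \<in> C \<Longrightarrow> dist x y \<le> d" "C \<subseteq> sphere 0 1"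
    and d: "0 < d" "d \<le> s" and s: "s \<le> 1"
  obtains W where "W \<in> sets borel" "\<And>t x. x \<in> C \<Longrightarrow> 1 \<le> t \<Longrightarrow> t \<le> 1 + s \<Longrightarrow> t *\<^sub>R x \<in> W"
    "emeasure lborel W \<le> ennreal (2 * s * 3 ^ DIM('a) * unit_ball_vol (DIM('a)) * d ^ (DIM('a) - 1))"
proof (cases "C = {}")
  case True
  show ?thesis by (rule that[of "{}"]) (use True in auto)
next
  case False
  then obtain x where x: "x \<in> C" by auto
  \<comment> \<open>The radial segment of length \<open>s\<close> is cut into steps of length
    \<open>d\<close>. The radius \<open>3 * d\<close> below allows \<open>2 * d\<close> for
    replacing a point of \<open>C\<close> by \<open>x\<close> (the radial factor is at most 2) and
    \<open>d\<close> for rounding the radius. Since \<open>d \<le> s\<close>, the extra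
    \<open>+ 1\<close> is absorbed in \<open>N \<le> 2 * s / d\<close>, which lowers the power of
    \<open>d\<close> by one.\<close>
  define N where "N = nat \<lfloor>s / d\<rfloor> + 1"
  define W where "W = (\<Union>j<N. cball ((1 + real j * d) *\<^sub>R x) (3 * d))"
  have "real (nat \<lfloor>s / d\<rfloor>) \<le> s / d" using d s by (simp add: of_nat_nat)
  moreover have "1 \<le> s / d" using d by (simp add: field_simps)
  ultimately have N: "real N \<le> 2 * s / d" unfolding N_def of_nat_add of_nat_1 by linarith
  show ?thesis
  proof (rule that[of W])
    show "W \<in> sets borel" by (auto simp: W_def)
    fix t y assume y: "y \<in> C" and t: "1 \<le> t" "t \<le> 1 + s"
    define j where "j = nat \<lfloor>(t - 1) / d\<rfloor>"
    have jr: "real j = of_int \<lfloor>(t - 1) / d\<rfloor>" using t d by (simp add: j_def)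
    have j1: "real j * d \<le> t - 1" "t - 1 \<le> real j * d + d"
    proof -
      have "real j \<le> (t - 1) / d" "(t - 1) / d \<le> real j + 1" unfolding jr by linarith+
      then show "real j * d \<le> t - 1" "t - 1 \<le> real j * d + d" using d by (auto simp: field_simps)
    qed
    have "j \<le> nat \<lfloor>s / d\<rfloor>" unfolding j_def
      by (intro nat_mono floor_mono divide_right_mono) (use t d in auto)
    then have jN: "j < N" by (simp add: N_def)
    have xn: "norm x = 1" "norm y = 1" using x y C(2) by auto
    have "dist ((1 + real j * d) *\<^sub>R x) (t *\<^sub>R y) = norm ((1 + real j * d) *\<^sub>R (x - y) + (1 + real j * d - t) *\<^sub>R y)"
      by (simp add: dist_norm algebra_simps)
    also have "\<dots> \<le> (1 + real j * d) * norm (x - y) + \<bar>1 + real j * d - t\<bar>"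
      by (rule norm_triangle_le) (use xn d in simp)
    also have "\<dots> \<le> 2 * d + d"
    proof (intro add_mono mult_mono)
      show "norm (x - y) \<le> d" using C(1)[OF x y] by (simp add: dist_norm)
    qed (use j1 t s d in auto)
    finally show "t *\<^sub>R y \<in> W" using jN unfolding W_def by auto
  next
    have "emeasure lborel W \<le> (\<Sum>j<N. emeasure lborel (cball ((1 + real j * d) *\<^sub>R x) (3 * d)))"
      unfolding W_def by (rule emeasure_subadditive_finite) auto
    also have "\<dots> = ennreal (real N * (unit_ball_vol (DIM('a)) * (3 * d) ^ DIM('a)))"
      using d by (simp add: emeasure_cball ennreal_mult' ennreal_of_nat_eq_real_of_nat)
    also have "\<dots> \<le> ennreal (2 * s / d * (unit_ball_vol (DIM('a)) * (3 * d) ^ DIM('a)))"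
      by (intro ennreal_leI mult_right_mono N) (use d in auto)
    also have "2 * s / d * (unit_ball_vol (DIM('a)) * (3 * d) ^ DIM('a)) =
       2 * s * 3 ^ DIM('a) * unit_ball_vol (DIM('a)) * d ^ (DIM('a) - 1)"
      using d DIM_positive[where 'a='a] by (cases "DIM('a)") (auto simp: power_mult_distrib field_simps)
    finally show "emeasure lborel W \<le> ennreal (2 * s * 3 ^ DIM('a) * unit_ball_vol (DIM('a)) * d ^ (DIM('a) - 1))" .
  qed
qed

text \<open>A cover of the cap thickens to a cover of a ball of radius \<open>s / 8\<close> in the
  ambient space. Each thickening has volume at most \<open>K * s\<close> times the gauge of its set,
  so comparing volumes and cancelling \<open>K * s\<close> bounds the sum of the gauges from
  below.\<close>

lemma hausdorff_outer_cap_ge: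
  assumes dim: "DIM('a::euclidean_space) \<ge> 2"
  obtains c where "c > 0"
    "\<And>(v::'a) s. norm v = 1 \<Longrightarrow> 0 < s \<Longrightarrow> s \<le> 1 \<Longrightarrow>
       ennreal (c * s ^ (DIM('a) - 1)) \<le> hausdorff_outer (DIM('a) - 1) (sphere 0 1 \<inter> ball v s)"
proof -
  let ?n = "DIM('a)"
  let ?k = "DIM('a) - 1"
  \<comment> \<open>The factor \<open>2 ^ ?k / unit_ball_vol ?k\<close> undoes the normalisation of
    the gauge in the volume bound for thickenings; the power of \<open>1/8\<close> in
    \<open>c\<close> comes from the radius of the covered ball.\<close>
  define K where "K = 2 * 3 ^ ?n * unit_ball_vol ?n * 2 ^ ?k / unit_ball_vol ?k"
  have K: "K > 0" by (simp add: K_def)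
  define c where "c = unit_ball_vol ?n * (1/8) ^ ?n / K"
  have c: "c > 0" using K by (simp add: c_def)
  show ?thesis
  proof (rule that[OF c])
    fix v :: 'a and s :: real
    assume v: "norm v = 1" and s: "0 < s" "s \<le> 1"
    let ?A = "sphere 0 1 \<inter> ball v s"
    \<comment> \<open>The content at scale \<open>s\<close> is enough: it lies below the outer
      measure, and its covering sets have diameter at most \<open>s\<close>, as the thickening
      estimate requires.\<close>
    have "ennreal (c * s ^ ?k) \<le> hausdorff_content ?k s ?A"
      unfolding hausdorff_content_def
    proof (rule INF_greatest, clarify)
      fix C :: "nat \<Rightarrow> 'a set"
      assume C: "?A \<subseteq> (\<Union>i. C i)" "\<forall>i. bounded (C i) \<and> diameter (C i) \<le> s"
      have "\<exists>W. W \<in> sets borel \<and> (\<forall>t x. x \<in> C i \<inter> sphere 0 1 \<longrightarrow> 1 \<le> t \<longrightarrow> t \<le> 1 + s \<longrightarrow> t *\<^sub>R x \<in> W) \<and>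
            emeasure lborel W \<le> ennreal (K * s) * hausdorff_gauge ?k (C i)" for i
      proof -
        consider "C i = {}" | "C i \<noteq> {}" "diameter (C i) = 0" | "C i \<noteq> {}" "diameter (C i) > 0"
          using diameter_ge_0[of "C i"] C(2) by fastforce
        then show ?thesis
        proof cases
          case 1
          then show ?thesis by (intro exI[of _ "{}"]) auto
        next
          \<comment> \<open>A one-point set has gauge 0 because \<open>?k \<ge> 1\<close>, so its
            thickening must be null. It lies on a line, which is null in dimension at least
            2.\<close>
          case 2
          then obtain x where x: "x \<in> C i" by auto
          have sing: "y = x" if "y \<in> C i" for y
            using diameter_bounded_bound[of "C i" y x] that x C(2) 2 by simp
          have "negligible (span {x})"
            by (rule negligible_lowdim) (use dim dim_le_card'[of "{x}"] in simp)
          then have "emeasure lborel (span {x}) = 0"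
            by (auto simp: negligible_iff_null_sets null_sets_def)
          moreover have "span {x} \<in> sets borel" by (intro borel_closed closed_span)
          ultimately show ?thesis
            by (intro exI[of _ "span {x}"]) (auto dest!: sing intro: span_scale span_base)
        next
          case 3
          let ?d = "diameter (C i)"
          obtain W where W: "W \<in> sets borel" "\<And>t x. x \<in> C i \<inter> sphere 0 1 \<Longrightarrow> 1 \<le> t \<Longrightarrow> t \<le> 1 + s \<Longrightarrow> t *\<^sub>R x \<in> W"
            "emeasure lborel W \<le> ennreal (2 * s * 3 ^ ?n * unit_ball_vol ?n * ?d ^ ?k)"
            by (rule radial_thickening_cover[of "C i \<inter> sphere 0 1" ?d s])
               (use C(2) 3 s in \<open>auto intro: diameter_bounded_bound\<close>)
          have "2 * s * 3 ^ ?n * unit_ball_vol ?n * ?d ^ ?k = K * s * (unit_ball_vol ?k * (?d / 2) ^ ?k)"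
            by (simp add: K_def power_divide less_imp_neq[OF unit_ball_vol_pos, symmetric])
          note W(3)[unfolded this]
          also have "\<dots> = ennreal (K * s) * hausdorff_gauge ?k (C i)"
            using 3 K s by (simp only: hausdorff_gauge_def if_False, intro ennreal_mult) auto
          finally have "emeasure lborel W \<le> ennreal (K * s) * hausdorff_gauge ?k (C i)" .
          with W show ?thesis by blast
        qed
      qed
      then obtain W where W: "\<And>i. W i \<in> sets borel"
        "\<And>i t x. x \<in> C i \<Longrightarrow> norm x = 1 \<Longrightarrow> 1 \<le> t \<Longrightarrow> t \<le> 1 + s \<Longrightarrow> t *\<^sub>R x \<in> W i"
        "\<And>i. emeasure lborel (W i) \<le> ennreal (K * s) * hausdorff_gauge ?k (C i)"
        by (metis IntI mem_sphere_0)
      \<comment> \<open>Norms in the ball of radius \<open>s / 8\<close> about \<open>?p\<close>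
        differ from \<open>1 + s / 2\<close> by less than \<open>s / 8\<close>, so the ball stays
        inside the shell. Radial projection moves its points to within \<open>s / 4\<close> of
        \<open>v\<close>, hence into the cap.\<close>
      let ?p = "(1 + s / 2) *\<^sub>R v"
      have sub: "ball ?p (s / 8) \<subseteq> (\<Union>i. W i)"
      proof
        fix y assume "y \<in> ball ?p (s / 8)"
        then have y: "norm (y - ?p) < s / 8" by (simp add: dist_norm norm_minus_commute)
        have np: "norm ?p = 1 + s / 2" using v s by simp
        have ny: "\<bar>norm y - (1 + s / 2)\<bar> < s / 8"
          using norm_triangle_ineq3[of y ?p] y np by linarith
        then have ny1: "1 \<le> norm y" "norm y \<le> 1 + s" using s by linarith+
        define w where "w = y /\<^sub>R norm y"
        have "norm y \<noteq> 0" using ny1 by linarith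
        then have yw: "y = norm y *\<^sub>R w" and w1: "norm w = 1" using ny1 by (auto simp: w_def)
        have "norm (w - v) \<le> norm y * norm (w - v)" using ny1 by (simp add: mult_le_cancel_right1)
        also have "\<dots> = norm (y - norm y *\<^sub>R v)" 
          by (subst (2) yw) (simp add: scaleR_diff_right[symmetric])
        also have "y - norm y *\<^sub>R v = (y - ?p) + ((1 + s / 2) - norm y) *\<^sub>R v"
          by (simp add: algebra_simps)
        also have "norm \<dots> \<le> norm (y - ?p) + \<bar>(1 + s / 2) - norm y\<bar>"
          by (rule norm_triangle_le) (simp add: v)
        also have "\<dots> < s" using y ny s by linarith
        finally have "w \<in> ?A" using w1 by (simp add: dist_norm norm_minus_commute)
        then obtain i where "w \<in> C i" using C(1) by auto
        from W(2)[OF this w1 ny1] yw show "y \<in> (\<Union>i. W i)" by auto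
      qed
      have "ennreal (K * s) * ennreal (c * s ^ ?k) = ennreal (unit_ball_vol ?n * (s / 8) ^ ?n)"
      proof -
        have "s * s ^ ?k = s ^ ?n" using dim by (cases "DIM('a)") auto
        then have "K * s * (c * s ^ ?k) = unit_ball_vol ?n * (s / 8) ^ ?n"
          using K by (simp add: c_def power_divide power_one_over)
        then show ?thesis using K c s by (simp add: ennreal_mult[symmetric])
      qed
      also have "\<dots> = emeasure lborel (ball ?p (s / 8))" using s by (simp add: emeasure_ball)
      also have "\<dots> \<le> emeasure lborel (\<Union>i. W i)" by (rule emeasure_mono[OF sub]) (use W in auto)
      also have "\<dots> \<le> (\<Sum>i. emeasure lborel (W i))" by (rule emeasure_subadditive_countably) (use W in auto)
      also have "\<dots> \<le> (\<Sum>i. ennreal (K * s) * hausdorff_gauge ?k (C i))"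
        by (intro suminf_le W) auto
      also have "\<dots> = ennreal (K * s) * (\<Sum>i. hausdorff_gauge ?k (C i))" by simp
      finally show "ennreal (c * s ^ ?k) \<le> (\<Sum>i. hausdorff_gauge ?k (C i))"
        using K s by (simp add: ennreal_mult_le_mult_iff)
    qed
    also have "\<dots> \<le> hausdorff_outer ?k ?A" by (rule hausdorff_content_le_outer[OF s(1)])
    finally show "ennreal (c * s ^ ?k) \<le> hausdorff_outer ?k ?A" .
  qed
qed

section \<open>Finiteness of the spherical measure by a packing argument\<close>

text \<open>The balls of radius \<open>d / 2\<close> about the points are disjoint and lie in the
  shell between the radii \<open>1 - d/2\<close> and \<open>1 + d/2\<close>. The shell, unlike a
  full ball, has volume of order \<open>d\<close>, and this saves the one power of \<open>d\<close>
  that finiteness in dimension \<open>n - 1\<close> requires.\<close>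

lemma card_separated_sphere_le:
  fixes X :: "'a::euclidean_space set"
  assumes X: "X \<subseteq> sphere 0 1" "finite X"
    and sep: "\<And>x y. x \<in> X \<Longrightarrow> y \<in> X \<Longrightarrow> x \<noteq> y \<Longrightarrow> d \<le> dist x y" and d: "0 < d" "d \<le> 1"
  shows "real (card X) * d ^ (DIM('a) - 1) \<le> real DIM('a) * 4 ^ DIM('a)"
proof -
  let ?n = "DIM('a)"
  let ?w = "unit_ball_vol ?n"
  let ?U = "\<Union>x\<in>X. ball x (d/2)"
  have "disjoint_family_on (\<lambda>x. ball x (d/2)) X"
    unfolding disjoint_family_on_def
  proof (intro ballI impI)
    fix x y assume "x \<in> X" "y \<in> X" "x \<noteq> y"
    with sep[of x y] show "ball x (d/2) \<inter> ball y (d/2) = {}"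
      by (intro disjoint_ballI) auto
  qed
  then have "emeasure lborel ?U = (\<Sum>x\<in>X. emeasure lborel (ball x (d/2)))"
    by (intro sum_emeasure[symmetric] X(2)) auto
  then have 1: "emeasure lborel ?U = ennreal (real (card X) * (?w * (d/2) ^ ?n))"
    using d by (simp add: emeasure_ball ennreal_mult' ennreal_of_nat_eq_real_of_nat)
  have ny: "\<bar>norm y - 1\<bar> < d / 2" if "y \<in> ?U" for y
  proof -
    from that obtain x where x: "x \<in> X" "norm (y - x) < d / 2" by (auto simp: dist_norm norm_minus_commute)
    with norm_triangle_ineq3[of y x] X(1) show ?thesis by auto
  qed
  have sub: "?U \<subseteq> cball 0 (1 + d/2)" "?U \<inter> ball 0 (1 - d/2) = {}"
  proof -
    show "?U \<subseteq> cball 0 (1 + d/2)"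
    proof
      fix y assume "y \<in> ?U" from ny[OF this] show "y \<in> cball 0 (1 + d/2)" unfolding mem_cball_0 by linarith
    qed
    have "y \<notin> ball 0 (1 - d/2)" if "y \<in> ?U" for y using ny[OF that] unfolding mem_ball_0 by linarith
    then show "?U \<inter> ball 0 (1 - d/2) = {}" by blast
  qed
  have "open ?U" by auto
  then have "emeasure lborel ?U + emeasure lborel (ball 0 (1 - d/2) :: 'a set) = emeasure lborel (?U \<union> ball 0 (1 - d/2))"
    by (intro plus_emeasure sub) auto
  also have "\<dots> \<le> emeasure lborel (cball 0 (1 + d/2) :: 'a set)"
    by (rule emeasure_mono) (use sub d in auto)
  finally have "real (card X) * (?w * (d/2) ^ ?n) + ?w * (1 - d/2) ^ ?n \<le> ?w * (1 + d/2) ^ ?n"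
    unfolding 1 using d by (simp add: emeasure_ball emeasure_cball ennreal_plus[symmetric] del: ennreal_plus)
  then have "?w * (real (card X) * (d/2) ^ ?n) \<le> ?w * ((1 + d/2) ^ ?n - (1 - d/2) ^ ?n)"
    by (simp add: algebra_simps)
  then have "real (card X) * (d/2) ^ ?n \<le> (1 + d/2) ^ ?n - (1 - d/2) ^ ?n"
    by (simp only: mult_le_cancel_left_pos[OF unit_ball_vol_pos[of "real ?n"]] of_nat_0_le_iff)
  \<comment> \<open>Factoring the difference of powers extracts the thickness \<open>d\<close> of
    the shell; each remaining summand is at most \<open>2 ^ ?n\<close>.\<close>
  also have "\<dots> \<le> d * (real ?n * 2 ^ ?n)"
  proof -
    have "(1 + d/2) ^ ?n - (1 - d/2) ^ ?n = (1 + d/2 - (1 - d/2)) * (\<Sum>i<?n. (1 + d/2) ^ i * (1 - d/2) ^ (?n - Suc i))"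
      by (simp only: power_diff_sumr2 mult.commute)
    also have "\<dots> = d * (\<Sum>i<?n. (1 + d/2) ^ i * (1 - d/2) ^ (?n - Suc i))" by simp
    also have "\<dots> \<le> d * (\<Sum>i<?n. 2 ^ ?n * 1)"
    proof (intro mult_left_mono sum_mono mult_mono)
      fix i assume "i \<in> {..<?n}"
      then have "(1 + d/2) ^ i \<le> 2 ^ i" "(2::real) ^ i \<le> 2 ^ ?n"
        using d by (auto intro: power_mono)
      then show "(1 + d/2) ^ i \<le> 2 ^ ?n" by linarith
    qed (use d in \<open>auto intro: power_le_one\<close>)
    finally show ?thesis by simp
  qed
  finally have "d * (real (card X) * d ^ (?n - 1) / 2 ^ ?n) \<le> d * (real ?n * 2 ^ ?n)"
    using DIM_positive[where 'a='a] by (cases ?n) (auto simp: power_divide field_simps)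
  then have "real (card X) * d ^ (?n - 1) / 2 ^ ?n \<le> real ?n * 2 ^ ?n"
    using d by (simp only: mult_le_cancel_left_pos)
  then show ?thesis by (simp add: field_simps power_mult_distrib[symmetric])
qed

text \<open>A separated set of largest cardinality is also a net, so the sphere is covered by balls
  of radius \<open>d\<close> about its points. By the packing bound their total gauge is at most
  \<open>M\<close>, independently of \<open>d\<close>.\<close>

lemma hausdorff_outer_sphere_finite:
  "hausdorff_outer (DIM('a) - 1) (sphere 0 1 :: 'a::euclidean_space set) < \<infinity>"
proof -
  let ?n = "DIM('a)"
  let ?k = "DIM('a) - 1"
  let ?S = "sphere 0 1 :: 'a set"
  define M where "M = unit_ball_vol ?k * (real ?n * 4 ^ ?n)"
  have small: "hausdorff_content ?k (2 * d) ?S \<le> ennreal M" if d: "0 < d" "d \<le> 1" for d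
  proof -
    define Sep where "Sep = (\<lambda>X. X \<subseteq> ?S \<and> finite X \<and> (\<forall>x\<in>X. \<forall>y\<in>X. x \<noteq> y \<longrightarrow> d \<le> dist x y))"
    define b where "b = nat \<lfloor>real ?n * 4 ^ ?n / d ^ ?k\<rfloor>"
    have "Sep {}" by (simp add: Sep_def)
    moreover have "card X \<le> b" if "Sep X" for X
    proof -
      have "real (card X) * d ^ ?k \<le> real ?n * 4 ^ ?n"
        by (rule card_separated_sphere_le) (use that d in \<open>auto simp: Sep_def\<close>)
      then have "real (card X) \<le> real ?n * 4 ^ ?n / d ^ ?k" using d by (simp add: field_simps)
      then show ?thesis unfolding b_def by linarith
    qed
    ultimately obtain X where X: "Sep X" and max: "\<And>Y. Sep Y \<Longrightarrow> card Y \<le> card X"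
      using Lattices_Big.ex_has_greatest_nat[of Sep "{}" card "Suc b"] by (metis le_imp_less_Suc)
    have fX: "finite X" using X by (simp add: Sep_def)
    have cov: "?S \<subseteq> (\<Union>x\<in>X. cball x d)"
    proof (rule ccontr)
      assume "\<not> ?thesis"
      then obtain y where y: "y \<in> ?S" "\<And>x. x \<in> X \<Longrightarrow> d < dist x y" by force
      then have "Sep (insert y X)" using X d unfolding Sep_def
        by (auto simp: dist_commute less_imp_le)
      moreover have "y \<notin> X" using y(2)[of y] d by auto
      ultimately show False using max[of "insert y X"] fX by simp
    qed
    obtain f where f: "f ` {..<card X} = X"
      using bij_betw_from_nat_into_finite[OF fX] by (auto simp: bij_betw_def)
    define N where "N = card X"
    define C where "C = (\<lambda>i. if i < N then cball (f i) d else {})"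
    have "hausdorff_content ?k (2 * d) ?S \<le> (\<Sum>i. hausdorff_gauge ?k (C i))"
    proof (rule hausdorff_content_le)
      show "?S \<subseteq> (\<Union>i. C i)"
      proof
        fix y assume "y \<in> ?S"
        then obtain x where x: "x \<in> X" "y \<in> cball x d" using cov by blast
        then obtain i where "i < N" "x = f i" using f unfolding N_def by blast
        then show "y \<in> (\<Union>i. C i)" using x by (auto simp: C_def)
      qed
    qed (use d in \<open>auto simp: C_def diameter_cball\<close>)
    also have "\<dots> = (\<Sum>i<N. hausdorff_gauge ?k (C i))"
      by (rule suminf_finite) (auto simp: C_def hausdorff_gauge_def)
    also have "\<dots> = (\<Sum>i<N. ennreal (unit_ball_vol ?k * d ^ ?k))"
      by (rule sum.cong) (use d in \<open>auto simp: C_def hausdorff_gauge_def\<close>)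
    also have "\<dots> = ennreal (unit_ball_vol ?k * (real N * d ^ ?k))"
      using d by (simp add: ennreal_of_nat_eq_real_of_nat ennreal_mult'[symmetric] mult_ac)
    also have "\<dots> \<le> ennreal M" unfolding M_def N_def
      by (intro ennreal_leI mult_left_mono card_separated_sphere_le)
         (use X d in \<open>auto simp: Sep_def\<close>)
    finally show ?thesis .
  qed
  have "hausdorff_outer ?k ?S \<le> ennreal M"
    unfolding hausdorff_outer_def
  proof (rule SUP_least)
    fix d :: real assume "d \<in> {0<..}"
    \<comment> \<open>The packing bound covers radii up to 1 only; for larger scales, shrinking the
      scale can only increase the content.\<close>
    then have "hausdorff_content ?k d ?S \<le> hausdorff_content ?k (2 * min 1 (d / 2)) ?S"
      by (intro hausdorff_content_antimono) auto
    also have "\<dots> \<le> ennreal M" using \<open>d \<in> {0<..}\<close> by (intro small) auto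
    finally show "hausdorff_content ?k d ?S \<le> ennreal M" .
  qed
  then show ?thesis by (simp add: le_less_trans)
qed

section \<open>Integrals of radial functions\<close>

lemma finite_measure_spherical_measure:
  "finite_measure (spherical_measure :: 'a::euclidean_space measure)"
  by (rule finite_measureI)
     (use hausdorff_outer_sphere_finite[where 'a='a] in \<open>simp add: emeasure_spherical_measure less_top[symmetric]\<close>)

lemma measure_spherical_cap_ge:
  assumes dim: "DIM('a::euclidean_space) \<ge> 2"
  obtains c where "c > 0"
    "\<And>(v::'a) s. norm v = 1 \<Longrightarrow> 0 < s \<Longrightarrow> s \<le> 1 \<Longrightarrow>
       c * s ^ (DIM('a) - 1) \<le> measure spherical_measure (sphere 0 1 \<inter> ball v s)"
proof -
  obtain c where c: "c > 0" "\<And>(v::'a) s. norm v = 1 \<Longrightarrow> 0 < s \<Longrightarrow> s \<le> 1 \<Longrightarrow>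
       ennreal (c * s ^ (DIM('a) - 1)) \<le> hausdorff_outer (DIM('a) - 1) (sphere 0 1 \<inter> ball v s)"
    using hausdorff_outer_cap_ge[OF dim] by metis
  interpret finite_measure "spherical_measure :: 'a measure" by (rule finite_measure_spherical_measure)
  show ?thesis
  proof (rule that[OF c(1)])
    fix v :: 'a and s :: real assume *: "norm v = 1" "0 < s" "s \<le> 1"
    have "ennreal (c * s ^ (DIM('a) - 1)) \<le> emeasure spherical_measure (sphere 0 1 \<inter> ball v s)"
      using c(2)[OF *] by (subst emeasure_spherical_measure) auto
    then show "c * s ^ (DIM('a) - 1) \<le> measure spherical_measure (sphere 0 1 \<inter> ball v s)"
      by (simp add: emeasure_eq_measure)
  qed
qed

lemma integrable_spherical_measure:
  fixes f :: "'a::euclidean_space \<Rightarrow> real"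
  assumes "continuous_on (sphere 0 1) f"
  shows "integrable spherical_measure f"
proof -
  interpret finite_measure "spherical_measure :: 'a measure" by (rule finite_measure_spherical_measure)
  have "bounded (f ` sphere 0 1)"
    using assms by (intro compact_imp_bounded compact_continuous_image) auto
  then obtain B where "\<And>v. v \<in> sphere 0 1 \<Longrightarrow> norm (f v) \<le> B"
    unfolding bounded_iff by blast
  then show ?thesis
    using borel_measurable_continuous_on_restrict[OF assms]
    by (intro integrable_const_bound[of _ B] AE_I2)
       (simp_all add: measurable_cong_sets[OF sets_spherical_measure refl])
qed

section \<open>Monotonicity and convergence of integrals of \<open>G\<close> along radial
  functions\<close>

lemma class_G_I_pos:
  assumes "G \<in> class_G_I" "0 < t" "v \<in> sphere 0 1"
  shows "0 < G t v"
  using assms unfolding class_G_I_def by blast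

lemma class_G_I_mono:
  assumes "G \<in> class_G_I" "0 < s" "s \<le> t" "v \<in> sphere 0 1"
  shows "G s v \<le> G t v"
proof -
  have "strict_mono_on {0<..} (\<lambda>t. G t v)" using assms(1,4) by (simp add: class_G_I_def)
  from strict_mono_on_leD[OF this, of s t] show ?thesis using assms by simp
qed

lemma class_G_I_strict_mono:
  assumes "G \<in> class_G_I" "0 < s" "s < t" "v \<in> sphere 0 1"
  shows "G s v < G t v"
proof -
  have "strict_mono_on {0<..} (\<lambda>t. G t v)" using assms(1,4) by (simp add: class_G_I_def)
  from strict_mono_onD[OF this, of s t] show ?thesis using assms by simp
qed

lemma class_G_I_continuous_on_radial:
  fixes G :: "real \<Rightarrow> 'a::euclidean_space \<Rightarrow> real"
  assumes "G \<in> class_G_I" "continuous_on (sphere 0 1) r" "\<And>v. v \<in> sphere 0 1 \<Longrightarrow> 0 < r v"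
  shows "continuous_on (sphere 0 1) (\<lambda>v. G (r v) v)"
proof -
  have "continuous_on ({0<..} \<times> sphere 0 1) (\<lambda>(t, u). G t u)" using assms(1) by (simp add: class_G_I_def)
  then have "continuous_on (sphere 0 1) (\<lambda>v. case (r v, v) of (t, u) \<Rightarrow> G t u)"
    by (rule continuous_on_compose2)
       (use assms(3) in \<open>auto intro!: continuous_on_Pair assms(2) continuous_on_id\<close>)
  then show ?thesis by simp
qed

lemma class_G_I_integrable_radial:
  fixes G :: "real \<Rightarrow> 'a::euclidean_space \<Rightarrow> real"
  assumes "G \<in> class_G_I" "continuous_on (sphere 0 1) r" "\<And>v. v \<in> sphere 0 1 \<Longrightarrow> 0 < r v"
  shows "integrable spherical_measure (\<lambda>v. G (r v) v)"
  by (rule integrable_spherical_measure[OF class_G_I_continuous_on_radial[OF assms]])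

lemma class_G_I_tendsto:
  assumes G: "G \<in> class_G_I" and v: "v \<in> sphere 0 1" and t: "t > 0" and f: "(f \<longlongrightarrow> t) F"
  shows "((\<lambda>k. G (f k) v) \<longlongrightarrow> G t v) F"
proof -
  have "continuous_on ({0<..} \<times> sphere 0 1) (\<lambda>(t, u). G t u)" using G by (simp add: class_G_I_def)
  then have "continuous_on {0<..} (\<lambda>s. case (s, v) of (t, u) \<Rightarrow> G t u)"
    by (rule continuous_on_compose2)
       (use v in \<open>auto intro!: continuous_on_Pair continuous_on_const continuous_on_id\<close>)
  then have "isCont (\<lambda>s. G s v) t" using t by (simp add: continuous_on_eq_continuous_at)
  from isCont_tendsto_compose[OF this f] show ?thesis .
qed

lemma integral_radial_mono:
  fixes G :: "real \<Rightarrow> 'a::euclidean_space \<Rightarrow> real"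
  assumes "G \<in> class_G_I" "continuous_on (sphere 0 1) r" "continuous_on (sphere 0 1) r'"
    and "\<And>v. v \<in> sphere 0 1 \<Longrightarrow> 0 < r v" "\<And>v. v \<in> sphere 0 1 \<Longrightarrow> r v \<le> r' v"
  shows "(\<integral>v. G (r v) v \<partial>spherical_measure) \<le> (\<integral>v. G (r' v) v \<partial>spherical_measure)"
proof (rule integral_mono)
  show "integrable spherical_measure (\<lambda>v. G (r v) v)"
    by (rule class_G_I_integrable_radial[OF assms(1,2,4)])
  show "integrable spherical_measure (\<lambda>v. G (r' v) v)"
    by (rule class_G_I_integrable_radial[OF assms(1,3) less_le_trans[OF assms(4,5)]])
qed (use assms(4,5) in \<open>simp add: class_G_I_mono[OF assms(1)]\<close>)

text \<open>Dominated convergence with majorant \<open>G b\<close>: monotonicity of \<open>G\<close>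
  turns the uniform bound \<open>b\<close> on the radial functions into an integrable bound.\<close>

lemma integral_radial_tendsto:
  fixes G :: "real \<Rightarrow> 'a::euclidean_space \<Rightarrow> real" and r :: "nat \<Rightarrow> 'a \<Rightarrow> real"
  assumes G: "G \<in> class_G_I"
    and r: "\<And>k. continuous_on (sphere 0 1) (r k)" "\<And>k v. v \<in> sphere 0 1 \<Longrightarrow> 0 < r k v"
      "\<And>k v. v \<in> sphere 0 1 \<Longrightarrow> r k v \<le> b"
    and r': "continuous_on (sphere 0 1) r'" "\<And>v. v \<in> sphere 0 1 \<Longrightarrow> 0 < r' v"
    and lim: "\<And>v. v \<in> sphere 0 1 \<Longrightarrow> (\<lambda>k. r k v) \<longlonglongrightarrow> r' v"
  shows "(\<lambda>k. \<integral>v. G (r k v) v \<partial>spherical_measure) \<longlonglongrightarrow> (\<integral>v. G (r' v) v \<partial>spherical_measure)"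
proof (rule integral_dominated_convergence[where w = "\<lambda>v. G b v"])
  obtain v0 :: 'a where "norm v0 = 1" using vector_choose_size[of 1] by auto
  then have b: "b > 0" using r(2,3)[of v0 0] by simp
  show "integrable spherical_measure (G b)"
    using class_G_I_integrable_radial[OF G, of "\<lambda>_. b"] b by simp
  show "(\<lambda>v. G (r' v) v) \<in> borel_measurable spherical_measure"
    by (rule borel_measurable_integrable[OF class_G_I_integrable_radial[OF G r']])
  show "(\<lambda>v. G (r k v) v) \<in> borel_measurable spherical_measure" for k
    by (rule borel_measurable_integrable[OF class_G_I_integrable_radial[OF G r(1,2)]])
  show "AE v in spherical_measure. (\<lambda>k. G (r k v) v) \<longlonglongrightarrow> G (r' v) v"
    by (rule AE_I2) (use class_G_I_tendsto[OF G _ r'(2) lim] in simp)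
  show "AE v in spherical_measure. norm (G (r k v) v) \<le> G b v" for k
  proof (intro AE_I2)
    fix v :: 'a assume "v \<in> space spherical_measure"
    then have v: "v \<in> sphere 0 1" by simp
    have "0 < G (r k v) v" by (rule class_G_I_pos[OF G r(2)[OF v] v])
    moreover have "G (r k v) v \<le> G b v"
      by (rule class_G_I_mono[OF G r(2)[OF v] r(3)[OF v] v])
    ultimately show "norm (G (r k v) v) \<le> G b v" by simp
  qed
qed

text \<open>The sphere is connected in dimension at least 2, and the distance to \<open>u\<close>
  takes the values 0 at \<open>u\<close> and 2 at \<open>-u\<close>. The points found here are the
  centres of the caps in the spike estimate.\<close>

lemma sphere_point_at_distance:
  fixes u :: "'a::euclidean_space"
  assumes "DIM('a) \<ge> 2" "norm u = 1" "0 \<le> s" "s \<le> 2"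
  obtains p where "norm p = 1" "norm (p - u) = s"
proof -
  have "connected ((\<lambda>v. norm (v - u)) ` sphere 0 1)"
    by (intro connected_continuous_image continuous_intros connected_sphere assms)
  moreover have "0 \<in> (\<lambda>v. norm (v - u)) ` sphere 0 1"
    using assms by (intro image_eqI[of _ _ u]) auto
  moreover have "2 \<in> (\<lambda>v. norm (v - u)) ` sphere 0 1"
  proof (intro image_eqI[of _ _ "-u"])
    have "- u - u = - (2 *\<^sub>R u)" by (simp add: scaleR_2)
    then show "2 = norm (- u - u)" using assms(2) by (simp only: norm_minus_cancel norm_scaleR)
  qed (use assms in auto)
  ultimately have "s \<in> (\<lambda>v. norm (v - u)) ` sphere 0 1"
    using assms(3,4) by (meson connectedD_interval)
  with that show ?thesis by auto
qed

text \<open>The exponent \<open>n - 1\<close> is critical: each of the disjoint caps of radius \<open>2\<^sup>-\<^sup>j / 4\<close> at distance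
  \<open>2\<^sup>-\<^sup>j\<close> from \<open>u\<close> contributes at least a fixed amount \<open>\<kappa>\<close> to the integral.\<close>

lemma integral_radial_spike_large:
  fixes G :: "real \<Rightarrow> 'a::euclidean_space \<Rightarrow> real"
  assumes dim: "DIM('a) \<ge> 2" and G: "G \<in> class_G_I"
    and c0: "c0 > 0" and q: "q \<ge> real DIM('a) - 1"
    and growth: "\<And>t v. T \<le> t \<Longrightarrow> v \<in> sphere 0 1 \<Longrightarrow> c0 * t powr q \<le> G t v"
    and u: "norm u = 1" and R: "R > 0"
  obtains a where "a > 0" "\<And>r z. 0 < z \<Longrightarrow> z < a \<Longrightarrow> continuous_on (sphere 0 1) r \<Longrightarrow>
     (\<And>v. v \<in> sphere 0 1 \<Longrightarrow> 1 / (z + R * norm (v - u)) \<le> r v) \<Longrightarrow>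
     V < (\<integral>v. G (r v) v \<partial>spherical_measure)"
proof -
  let ?\<sigma> = "spherical_measure :: 'a measure"
  let ?k = "DIM('a) - 1"
  interpret finite_measure ?\<sigma> by (rule finite_measure_spherical_measure)
  obtain c where c: "c > 0" "\<And>(v::'a) s. norm v = 1 \<Longrightarrow> 0 < s \<Longrightarrow> s \<le> 1 \<Longrightarrow>
       c * s ^ ?k \<le> measure ?\<sigma> (sphere 0 1 \<inter> ball v s)"
    using measure_spherical_cap_ge[OF dim] by metis
  define s where "s = (\<lambda>j::nat. (1/2::real) ^ j)"
  have s: "0 < s j" "s j \<le> 1" "s (Suc j) = s j / 2" for j by (auto simp: s_def power_le_one)
  have s_anti: "s j \<le> s i" if "i \<le> j" for i j using that unfolding s_def by (intro power_decreasing) auto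
  \<comment> \<open>On the \<open>j\<close>-th cap the distance to \<open>u\<close> is below
    \<open>2 * s j\<close>, and \<open>z\<close> will be at most \<open>s j\<close>; so
    \<open>b j\<close> is a lower bound for \<open>r\<close> there.\<close>
  define b where "b = (\<lambda>j. 1 / ((1 + 2 * R) * s j))"
  define M where "M = max T 1"
  have M: "T \<le> M" "1 \<le> M" by (auto simp: M_def)
  \<comment> \<open>From \<open>j0\<close> on, \<open>b j\<close> exceeds \<open>T\<close>, so the
    growth bound applies, and 1, so that its power with exponent \<open>q\<close> dominates the one
    with exponent \<open>?k\<close>.\<close>
  obtain j0 where j0: "s j0 < 1 / ((1 + 2 * R) * M)"
  proof -
    have "0 < 1 / ((1 + 2 * R) * M)" using R M by simp
    from real_arch_pow_inv[OF this, of "1/2"] show ?thesis using that unfolding s_def by auto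
  qed
  have b: "M \<le> b j" if "j0 \<le> j" for j
  proof -
    have "s j < 1 / ((1 + 2 * R) * M)" using s_anti[OF that] j0 by linarith
    moreover have pos: "0 < (1 + 2 * R) * M" "0 < (1 + 2 * R) * s j" using R s M by auto
    ultimately have "s j * ((1 + 2 * R) * M) < 1" by (simp only: pos_less_divide_eq)
    then have "M * ((1 + 2 * R) * s j) \<le> 1" by (simp only: mult_ac)
    then show ?thesis unfolding b_def by (simp only: pos_le_divide_eq[OF pos(2)])
  qed
  have "\<exists>p. norm p = 1 \<and> norm (p - u) = s j" for j
    by (rule sphere_point_at_distance[OF dim u, of "s j"]) (use s[of j] in auto)
  then obtain p where p: "\<And>j. norm (p j) = 1" "\<And>j. norm (p j - u) = s j" by metis
  define C where "C = (\<lambda>j. sphere 0 1 \<inter> ball (p j) (s j / 4))"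
  have C_dist: "3 / 4 * s j < norm (v - u)" "norm (v - u) < 5 / 4 * s j" if "v \<in> C j" for j v
  proof -
    have "norm (v - p j) < s j / 4" using that by (simp add: C_def dist_norm norm_minus_commute)
    moreover have "\<bar>norm (v - u) - norm (p j - u)\<bar> \<le> norm (v - p j)"
      using norm_triangle_ineq3[of "v - u" "p j - u"] by simp
    ultimately show "3 / 4 * s j < norm (v - u)" "norm (v - u) < 5 / 4 * s j" using p(2)[of j] by linarith+
  qed
  \<comment> \<open>The annuli do not overlap: halving \<open>s\<close> puts the outer radius
    \<open>5/8 * s i\<close> of the next one below the inner radius
    \<open>3/4 * s i\<close>.\<close>
  have C_disj: "i = j" if "v \<in> C i" "v \<in> C j" for i j v
  proof -
    have False if "i < j" "v \<in> C i" "v \<in> C j" for i j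
    proof -
      have "s j \<le> s (Suc i)" using that(1) by (intro s_anti) simp
      then have "s j \<le> s i / 2" by (simp add: s)
      then show False using C_dist[OF that(2)] C_dist[OF that(3)] s(1)[of i] by linarith
    qed
    then show ?thesis using that by (metis linorder_neqE_nat)
  qed
  have C_sets: "C j \<in> sets ?\<sigma>" for j
    by (auto simp: C_def sets_spherical_measure sets_restrict_space)
  have integrable_indicator: "integrable ?\<sigma> (indicator (C j) :: 'a \<Rightarrow> real)" for j
    using C_sets[of j] by (rule integrable_real_indicator) (simp add: emeasure_eq_measure)
  \<comment> \<open>In the product of the lower bound \<open>c0 * b j ^ ?k\<close> with the cap
    measure \<open>c * (s j / 4) ^ ?k\<close> the factors \<open>s j\<close> cancel; this is where
    the two exponents must match.\<close>
  define \<kappa> where "\<kappa> = c0 * c / ((1 + 2 * R) * 4) ^ ?k"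
  have \<kappa>: "\<kappa> > 0" using c0 c R by (simp add: \<kappa>_def)
  \<comment> \<open>\<open>N\<close> caps together exceed \<open>V\<close>. Taking
    \<open>s (j0 + N)\<close> as the threshold for \<open>z\<close> ensures
    \<open>z \<le> s j\<close> for all of them.\<close>
  obtain N :: nat where N: "V < real N * \<kappa>" using reals_Archimedean3[OF \<kappa>] by blast
  let ?J = "{j0..<j0 + N}"
  show ?thesis
  proof (rule that[of "s (j0 + N)"])
    show "0 < s (j0 + N)" by (rule s)
    fix r z assume z: "0 < z" "z < s (j0 + N)" and r: "continuous_on (sphere 0 1) r"
      and low: "\<And>v. v \<in> sphere 0 1 \<Longrightarrow> 1 / (z + R * norm (v - u)) \<le> r v"
    have rpos: "0 < r v" if "v \<in> sphere 0 1" for v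
    proof -
      have "0 < 1 / (z + R * norm (v - u))" using z R by (simp add: add_pos_nonneg)
      then show ?thesis using low[OF that] by linarith
    qed
    have G_low: "c0 * b j ^ ?k \<le> G (r v) v" if j: "j \<in> ?J" and v: "v \<in> C j" for j v
    proof -
      have vS: "v \<in> sphere 0 1" using v by (simp add: C_def)
      have "z \<le> s j" using z s_anti[of j "j0 + N"] j by simp
      moreover have "R * norm (v - u) \<le> R * (2 * s j)"
        using C_dist[OF v] s(1)[of j] R by (intro mult_left_mono) linarith+
      ultimately have "z + R * norm (v - u) \<le> (1 + 2 * R) * s j" by (simp add: algebra_simps)
      moreover have "0 < z + R * norm (v - u)" using z R by (simp add: add_pos_nonneg)
      ultimately have "b j \<le> 1 / (z + R * norm (v - u))" unfolding b_def by (intro divide_left_mono) auto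
      also have "\<dots> \<le> r v" by (rule low[OF vS])
      finally have "b j \<le> r v" .
      have bj: "T \<le> b j" "1 \<le> b j" using b[of j] j M by auto
      have "b j ^ ?k = b j powr real ?k" using bj by (intro powr_realpow[symmetric]) linarith
      also have "\<dots> \<le> b j powr q" using bj q dim by (intro powr_mono) (auto simp: of_nat_diff)
      finally have "c0 * b j ^ ?k \<le> c0 * b j powr q" using c0 by simp
      also have "\<dots> \<le> G (b j) v" by (rule growth[OF bj(1) vS])
      also have "\<dots> \<le> G (r v) v" by (rule class_G_I_mono[OF G _ \<open>b j \<le> r v\<close> vS]) (use bj in simp)
      finally show ?thesis .
    qed
    have "real N * \<kappa> = (\<Sum>j\<in>?J. \<kappa>)" by simp
    also have "\<dots> \<le> (\<Sum>j\<in>?J. c0 * b j ^ ?k * measure ?\<sigma> (C j))"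
    proof (rule sum_mono)
      fix j
      have "c * (s j / 4) ^ ?k \<le> measure ?\<sigma> (C j)"
        unfolding C_def using s[of j] p by (intro c(2)) auto
      then have "c0 * b j ^ ?k * (c * (s j / 4) ^ ?k) \<le> c0 * b j ^ ?k * measure ?\<sigma> (C j)"
        using c0 R s(1)[of j] by (intro mult_left_mono) (auto simp: b_def)
      also have "c0 * b j ^ ?k * (c * (s j / 4) ^ ?k) = c0 * c * (b j * (s j / 4)) ^ ?k"
        unfolding power_mult_distrib by simp
      also have "b j * (s j / 4) = 1 / ((1 + 2 * R) * 4)" using s(1)[of j] by (simp add: b_def)
      also have "c0 * c * (1 / ((1 + 2 * R) * 4)) ^ ?k = \<kappa>" by (simp add: \<kappa>_def divide_inverse power_inverse)
      finally show "\<kappa> \<le> c0 * b j ^ ?k * measure ?\<sigma> (C j)" .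
    qed
    also have "\<dots> = (\<Sum>j\<in>?J. \<integral>v. c0 * b j ^ ?k * indicator (C j) v \<partial>?\<sigma>)"
      using sets.sets_into_space[OF C_sets] by (simp add: Int_absorb2)
    also have "\<dots> = (\<integral>v. (\<Sum>j\<in>?J. c0 * b j ^ ?k * indicator (C j) v) \<partial>?\<sigma>)"
      by (rule Bochner_Integration.integral_sum[symmetric])
         (simp add: integrable_indicator)
    also have "\<dots> \<le> (\<integral>v. G (r v) v \<partial>?\<sigma>)"
    proof (rule integral_mono)
      show "integrable ?\<sigma> (\<lambda>v. \<Sum>j\<in>?J. c0 * b j ^ ?k * indicator (C j) v)"
        by (rule Bochner_Integration.integrable_sum)
           (simp add: integrable_indicator)
      show "integrable ?\<sigma> (\<lambda>v. G (r v) v)" by (rule class_G_I_integrable_radial[OF G r rpos])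
      fix v assume "v \<in> space ?\<sigma>"
      then have vS: "v \<in> sphere 0 1" by simp
      show "(\<Sum>j\<in>?J. c0 * b j ^ ?k * indicator (C j) v) \<le> G (r v) v"
      proof (cases "\<exists>j\<in>?J. v \<in> C j")
        case False
        then have "(\<Sum>j\<in>?J. c0 * b j ^ ?k * indicator (C j) v) = 0" by (intro sum.neutral) auto
        then show ?thesis using class_G_I_pos[OF G rpos[OF vS] vS] by simp
      next
        case True
        then obtain j where j: "j \<in> ?J" "v \<in> C j" by auto
        have "v \<in> C i \<longleftrightarrow> i = j" for i using C_disj j(2) by blast
        then have "(\<Sum>i\<in>?J. c0 * b i ^ ?k * indicator (C i) v) = (\<Sum>i\<in>?J. if i = j then c0 * b i ^ ?k else 0)"
          by (intro sum.cong) (simp_all add: indicator_def)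
        also have "\<dots> = c0 * b j ^ ?k" using j by simp
        also have "\<dots> \<le> G (r v) v" by (rule G_low[OF j])
        finally show ?thesis .
      qed
    qed
    finally show "V < (\<integral>v. G (r v) v \<partial>?\<sigma>)" using N by linarith
  qed
qed

section \<open>Convex bodies and polytopes with given normals\<close>

lemma convex_bodies_bdd_above:
  assumes "K \<in> convex_bodies"
  shows "bdd_above ((\<lambda>x. x \<bullet> v) ` K)"
proof -
  have "compact ((\<lambda>x. x \<bullet> v) ` K)"
    using assms by (intro compact_continuous_image continuous_intros) (simp add: convex_bodies_def)
  then show ?thesis by (intro bounded_imp_bdd_above compact_imp_bounded)
qed

lemma convex_bodies_zero: "K \<in> convex_bodies \<Longrightarrow> 0 \<in> K"
  unfolding convex_bodies_def using interior_subset by blast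

lemma inner_le_support_fun: "K \<in> convex_bodies \<Longrightarrow> x \<in> K \<Longrightarrow> x \<bullet> v \<le> support_fun K v"
  unfolding support_fun_def by (rule cSUP_upper[OF _ convex_bodies_bdd_above])

lemma support_fun_le:
  "K \<in> convex_bodies \<Longrightarrow> (\<And>x. x \<in> K \<Longrightarrow> x \<bullet> v \<le> b) \<Longrightarrow> support_fun K v \<le> b"
  unfolding support_fun_def using convex_bodies_zero by (intro cSUP_least) auto

lemma support_fun_pos:
  assumes K: "K \<in> convex_bodies" and v: "v \<noteq> 0"
  shows "0 < support_fun K v"
proof -
  obtain e where e: "e > 0" "cball 0 e \<subseteq> K"
    using K unfolding convex_bodies_def mem_interior_cball by blast
  let ?x = "(e / norm v) *\<^sub>R v"
  have "?x \<in> K" using e v by (intro subsetD[OF e(2)]) simp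
  from inner_le_support_fun[OF K this, of v] have "(e / norm v) * (v \<bullet> v) \<le> support_fun K v" by simp
  moreover have "0 < (e / norm v) * (v \<bullet> v)" using e v by simp
  ultimately show ?thesis by linarith
qed

text \<open>By Cauchy-Schwarz, a bound \<open>M\<close> on the norms in \<open>K\<close> is a
  Lipschitz constant.\<close>

lemma continuous_on_support_fun:
  assumes K: "K \<in> convex_bodies"
  shows "continuous_on A (support_fun K)"
proof -
  have "bounded K" using K by (simp add: convex_bodies_def compact_imp_bounded)
  then obtain M where M: "M > 0" "\<And>x. x \<in> K \<Longrightarrow> norm x \<le> M" unfolding bounded_pos by auto
  have le: "support_fun K v \<le> support_fun K w + M * dist v w" for v w
  proof (rule support_fun_le[OF K])
    fix x assume x: "x \<in> K"
    have "x \<bullet> v = x \<bullet> w + x \<bullet> (v - w)" by (simp add: inner_diff_right)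
    also have "x \<bullet> (v - w) \<le> norm x * norm (v - w)" by (rule norm_cauchy_schwarz)
    also have "\<dots> \<le> M * norm (v - w)" by (intro mult_right_mono M x) simp
    finally show "x \<bullet> v \<le> support_fun K w + M * dist v w"
      using inner_le_support_fun[OF K x, of w] by (simp add: dist_norm)
  qed
  have "M-lipschitz_on A (support_fun K)"
  proof (rule lipschitz_onI)
    fix v w
    show "dist (support_fun K v) (support_fun K w) \<le> M * dist v w"
      using le[of v w] le[of w v] by (auto simp: dist_real_def dist_commute abs_le_iff)
  qed (use M in simp)
  then show ?thesis by (rule lipschitz_on_continuous_on)
qed

text \<open>For \<open>c \<ge> 0\<close>, the point \<open>c *\<^sub>R v\<close> is in the polar
  exactly if \<open>c * support_fun K v \<le> 1\<close>, so the admissible \<open>c\<close> form a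
  closed interval. This turns dual volumes of polars into integrals of support functions.\<close>

lemma radial_fun_polar_body:
  assumes K: "K \<in> convex_bodies" and v: "v \<noteq> 0"
  shows "radial_fun (polar_body K) v = 1 / support_fun K v"
proof -
  have h: "0 < support_fun K v" by (rule support_fun_pos[OF K v])
  have "c *\<^sub>R v \<in> polar_body K \<longleftrightarrow> c \<le> 1 / support_fun K v" if c: "0 \<le> c" for c
  proof
    assume c: "c \<le> 1 / support_fun K v"
    show "c *\<^sub>R v \<in> polar_body K" unfolding polar_body_def
    proof clarify
      fix y assume "y \<in> K"
      then have "c * (y \<bullet> v) \<le> c * support_fun K v"
        using \<open>0 \<le> c\<close> by (intro mult_left_mono inner_le_support_fun[OF K])
      also have "\<dots> \<le> 1" using c h by (simp add: field_simps)
      finally show "c *\<^sub>R v \<bullet> y \<le> 1" by (simp add: inner_commute)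
    qed
  next
    assume *: "c *\<^sub>R v \<in> polar_body K"
    show "c \<le> 1 / support_fun K v"
    proof (cases "c = 0")
      case False
      have "support_fun K v \<le> 1 / c"
      proof (rule support_fun_le[OF K])
        fix x assume "x \<in> K"
        with * have "c * (x \<bullet> v) \<le> 1" by (auto simp: polar_body_def inner_commute)
        then show "x \<bullet> v \<le> 1 / c" using c False by (simp add: field_simps)
      qed
      then show ?thesis using h c False by (simp add: field_simps)
    qed (use h in simp)
  qed
  then have "{c. 0 \<le> c \<and> c *\<^sub>R v \<in> polar_body K} = {0..1 / support_fun K v}" by auto
  then show ?thesis unfolding radial_fun_def using h by simp
qed

lemma cball_convex_body: "cball 0 1 \<in> convex_bodies"
  by (simp add: convex_bodies_def)

lemma polar_body_cball: "polar_body (cball 0 1) = (cball 0 1 :: 'a::euclidean_space set)"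
proof (intro equalityI subsetI)
  fix x :: 'a assume x: "x \<in> polar_body (cball 0 1)"
  show "x \<in> cball 0 1"
  proof (cases "x = 0")
    case False
    then have "x /\<^sub>R norm x \<in> cball 0 1" by simp
    then have "x \<bullet> (x /\<^sub>R norm x) \<le> 1" using x unfolding polar_body_def by blast
    then show ?thesis using False by (simp add: power2_norm_eq_inner[symmetric] power2_eq_square mult.assoc[symmetric])
  qed simp
next
  fix x :: 'a assume x: "x \<in> cball 0 1"
  have "x \<bullet> y \<le> 1" if "norm y \<le> 1" for y
  proof -
    have "x \<bullet> y \<le> norm x * norm y" by (rule norm_cauchy_schwarz)
    also have "\<dots> \<le> 1" using x that by (intro mult_le_one) auto
    finally show ?thesis .
  qed
  then show "x \<in> polar_body (cball 0 1)" by (simp add: polar_body_def)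
qed

lemma support_fun_mono:
  assumes "K \<in> convex_bodies" "L \<in> convex_bodies" "K \<subseteq> L"
  shows "support_fun K v \<le> support_fun L v"
  using assms by (intro support_fun_le inner_le_support_fun) auto

lemma continuous_on_inverse_support_fun:
  assumes "K \<in> convex_bodies"
  shows "continuous_on (sphere 0 1) (\<lambda>v. 1 / support_fun K v)"
proof (intro continuous_on_divide continuous_on_const continuous_on_support_fun assms ballI)
  fix v :: 'a assume "v \<in> sphere 0 1"
  then have "v \<noteq> 0" by auto
  then show "support_fun K v \<noteq> 0" using support_fun_pos[OF assms] by fastforce
qed

lemma inverse_support_fun_pos:
  "K \<in> convex_bodies \<Longrightarrow> v \<in> sphere 0 1 \<Longrightarrow> 0 < 1 / support_fun K v"
  using support_fun_pos[of K v] by fastforce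

lemma dual_vol_polar_body:
  assumes "K \<in> convex_bodies"
  shows "dual_vol G (polar_body K) = (\<integral>v. G (1 / support_fun K v) v \<partial>spherical_measure)"
  unfolding dual_vol_def
proof (rule Bochner_Integration.integral_cong[OF refl])
  fix v :: 'a assume "v \<in> space spherical_measure"
  then have "v \<noteq> 0" by auto
  then show "G (radial_fun (polar_body K) v) v = G (1 / support_fun K v) v"
    by (simp add: radial_fun_polar_body[OF assms])
qed

section \<open>Polytopes as functions of the offsets of their bounding halfspaces\<close>

text \<open>The offsets \<open>z\<close> are free parameters: a halfspace may be redundant, and then
  its offset is strictly larger than the support number of the polytope.\<close>

definition support_polytope :: "('i \<Rightarrow> 'a::euclidean_space) \<Rightarrow> 'i set \<Rightarrow> ('i \<Rightarrow> real) \<Rightarrow> 'a set" where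
  "support_polytope u I z = (\<Inter>i\<in>I. {x. x \<bullet> u i \<le> z i})"

text \<open>Quantitative form of the hemisphere condition: the sum \<open>f\<close> of the positive
  parts of the inner products is continuous and positive on the compact sphere, so its minimum
  \<open>f v0\<close> is positive, and normalising \<open>x\<close> gives the constant
  \<open>card I / f v0\<close>.\<close>

lemma norm_le_of_hemisphere:
  fixes u :: "'i \<Rightarrow> 'a::euclidean_space"
  assumes I: "finite I" and spread: "not_in_closed_hemisphere (u ` I)"
  obtains r where "r > 0" "\<And>x b. (\<And>i. i \<in> I \<Longrightarrow> x \<bullet> u i \<le> b) \<Longrightarrow> 0 \<le> b \<Longrightarrow> norm x \<le> r * b"
proof -
  define f where "f v = (\<Sum>i\<in>I. max 0 (v \<bullet> u i))" for v
  obtain e :: 'a where e: "norm e = 1" using vector_choose_size[of 1] by auto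
  have "continuous_on (sphere 0 1) f" unfolding f_def by (intro continuous_intros)
  moreover have "sphere (0::'a) 1 \<noteq> {}" using e by auto
  ultimately obtain v0 where v0: "v0 \<in> sphere 0 1" "\<And>v. v \<in> sphere 0 1 \<Longrightarrow> f v0 \<le> f v"
    using continuous_attains_inf[OF compact_sphere, of 0 1 f] by blast
  obtain j where j: "j \<in> I" "u j \<bullet> v0 > 0"
    using spread v0(1) unfolding not_in_closed_hemisphere_def by blast
  have f0: "f v0 > 0" unfolding f_def
    by (rule sum_pos2[OF I j(1)]) (use j in \<open>auto simp: inner_commute\<close>)
  have cI: "real (card I) > 0" using I j by (auto simp: card_gt_0_iff)
  show ?thesis
  proof (rule that[of "real (card I) / f v0"])
    fix x b assume x: "\<And>i. i \<in> I \<Longrightarrow> x \<bullet> u i \<le> b" and b: "0 \<le> (b::real)"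
    show "norm x \<le> real (card I) / f v0 * b"
    proof (cases "x = 0")
      case True then show ?thesis using b cI f0 by simp
    next
      case False
      have "f v0 \<le> f (x /\<^sub>R norm x)" using False by (intro v0) simp
      also have "\<dots> \<le> (\<Sum>i\<in>I. b / norm x)" unfolding f_def
      proof (rule sum_mono)
        fix i assume "i \<in> I"
        from x[OF this] show "max 0 ((x /\<^sub>R norm x) \<bullet> u i) \<le> b / norm x"
          using False b by (simp add: divide_right_mono field_simps)
      qed
      finally show ?thesis using False f0 by (simp add: field_simps)
    qed
  qed (use f0 cI in simp)
qed

context
  fixes u :: "'i \<Rightarrow> 'a::euclidean_space" and I :: "'i set"
  assumes I: "finite I" and unit: "u ` I \<subseteq> sphere 0 1" and spread: "not_in_closed_hemisphere (u ` I)"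
begin

lemma index_nonempty: "I \<noteq> {}"
proof -
  obtain e :: 'a where "norm e = 1" using vector_choose_size[of 1] by auto
  then show ?thesis using spread unfolding not_in_closed_hemisphere_def by force
qed

lemma support_polytope_polyhedron: "polyhedron (support_polytope u I z)"
  unfolding support_polytope_def
  using I by (intro polyhedron_Inter) (auto simp: inner_commute[of _ "u _"] polyhedron_halfspace_le)

lemma support_polytope_bounded: "bounded (support_polytope u I z)"
proof -
  obtain r where r: "r > 0" "\<And>x b. (\<And>i. i \<in> I \<Longrightarrow> x \<bullet> u i \<le> b) \<Longrightarrow> 0 \<le> b \<Longrightarrow> norm x \<le> r * b"
    using norm_le_of_hemisphere[OF I spread] by metis
  have "norm x \<le> r * (\<Sum>i\<in>I. \<bar>z i\<bar>)" if "x \<in> support_polytope u I z" for x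
  proof (rule r(2))
    fix i assume i: "i \<in> I"
    have "x \<bullet> u i \<le> z i" using that i by (auto simp: support_polytope_def)
    also have "\<dots> \<le> \<bar>z i\<bar>" by simp
    also have "\<dots> \<le> (\<Sum>i\<in>I. \<bar>z i\<bar>)" by (rule member_le_sum[OF i]) (use I in auto)
    finally show "x \<bullet> u i \<le> (\<Sum>i\<in>I. \<bar>z i\<bar>)" .
  qed (simp add: sum_nonneg)
  then show ?thesis unfolding bounded_iff by blast
qed

lemma support_polytope_polytope: "polytope (support_polytope u I z)"
  by (simp add: polytope_eq_bounded_polyhedron support_polytope_polyhedron support_polytope_bounded)

lemma support_polytope_convex_body:
  assumes z: "\<And>i. i \<in> I \<Longrightarrow> 0 < z i"
  shows "support_polytope u I z \<in> convex_bodies"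
proof -
  let ?O = "\<Inter>i\<in>I. {x. x \<bullet> u i < z i}"
  have "open ?O" using I by (intro open_INT) (auto simp: inner_commute[of _ "u _"] open_halfspace_lt)
  moreover have "?O \<subseteq> support_polytope u I z" by (auto simp: support_polytope_def less_imp_le)
  moreover have "0 \<in> ?O" using z by auto
  ultimately have "0 \<in> interior (support_polytope u I z)" by (meson interiorI)
  then show ?thesis
    using support_polytope_polytope[of z]
    by (simp add: convex_bodies_def polytope_imp_compact polytope_imp_convex)
qed

lemma support_fun_support_polytope_le:
  assumes "\<And>i. i \<in> I \<Longrightarrow> 0 < z i" "i \<in> I"
  shows "support_fun (support_polytope u I z) (u i) \<le> z i"
  by (rule support_fun_le[OF support_polytope_convex_body[OF assms(1)]])
     (use assms(2) in \<open>auto simp: support_polytope_def\<close>)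

text \<open>Support numbers never exceed the offsets, so lowering each offset to the support number
  cuts nothing away, even if some halfspaces are redundant.\<close>

lemma support_polytope_has_face_normals:
  assumes "\<And>i. i \<in> I \<Longrightarrow> 0 < z i"
  shows "has_face_normals (support_polytope u I z) (u ` I)"
proof -
  let ?P = "support_polytope u I z"
  have P: "?P \<in> convex_bodies" by (rule support_polytope_convex_body[OF assms])
  have "?P \<subseteq> (\<Inter>v\<in>u ` I. {x. x \<bullet> v \<le> support_fun ?P v})"
    using inner_le_support_fun[OF P] by blast
  moreover have "(\<Inter>v\<in>u ` I. {x. x \<bullet> v \<le> support_fun ?P v}) \<subseteq> ?P"
  proof
    fix x assume x: "x \<in> (\<Inter>v\<in>u ` I. {x. x \<bullet> v \<le> support_fun ?P v})"
    have "x \<bullet> u i \<le> z i" if "i \<in> I" for i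
    proof -
      have "x \<bullet> u i \<le> support_fun ?P (u i)" using x that by blast
      also have "\<dots> \<le> z i" by (rule support_fun_support_polytope_le[OF assms that])
      finally show ?thesis .
    qed
    then show "x \<in> ?P" by (simp add: support_polytope_def)
  qed
  ultimately show ?thesis unfolding has_face_normals_def by (rule equalityI)
qed

text \<open>The inequalities between the offsets place the first polytope inside the dilate by
  \<open>t\<close> of the second.\<close>

lemma support_fun_support_polytope_scale:
  assumes z: "\<And>i. i \<in> I \<Longrightarrow> 0 < z i" "\<And>i. i \<in> I \<Longrightarrow> 0 < z' i" and t: "0 < t"
    and le: "\<And>i. i \<in> I \<Longrightarrow> z i \<le> t * z' i"
  shows "support_fun (support_polytope u I z) v \<le> t * support_fun (support_polytope u I z') v"
proof (rule support_fun_le[OF support_polytope_convex_body[OF z(1)]])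
  fix x assume x: "x \<in> support_polytope u I z"
  have "(x /\<^sub>R t) \<bullet> u i \<le> z' i" if "i \<in> I" for i
  proof -
    have "x \<bullet> u i \<le> t * z' i" using x le[OF that] that unfolding support_polytope_def by force
    then show ?thesis using t by (simp add: field_simps)
  qed
  then have "x /\<^sub>R t \<in> support_polytope u I z'" by (simp add: support_polytope_def)
  from inner_le_support_fun[OF support_polytope_convex_body[OF z(2)] this, of v]
  show "x \<bullet> v \<le> t * support_fun (support_polytope u I z') v" using t by (simp add: field_simps)
qed

text \<open>Because the normals have length 1, offsets of at least \<open>a\<close> leave room for
  the point \<open>a *\<^sub>R v\<close>. This later bounds the radial functions of the polars by
  \<open>1 / a\<close>.\<close>

lemma support_fun_support_polytope_ge:
  assumes a: "0 < a" and z: "\<And>i. i \<in> I \<Longrightarrow> a \<le> z i" and v: "norm v = 1"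
  shows "a \<le> support_fun (support_polytope u I z) v"
proof -
  have z0: "0 < z i" if "i \<in> I" for i using z[OF that] a by linarith
  have "(a *\<^sub>R v) \<bullet> u i \<le> z i" if "i \<in> I" for i
  proof -
    have "norm (u i) = 1" using unit that by auto
    then have "v \<bullet> u i \<le> 1" using norm_cauchy_schwarz[of v "u i"] v by simp
    then have "a * (v \<bullet> u i) \<le> a * 1" using a by (intro mult_left_mono) auto
    then show ?thesis using z[OF that] by simp
  qed
  then have "a *\<^sub>R v \<in> support_polytope u I z" by (simp add: support_polytope_def)
  from inner_le_support_fun[OF support_polytope_convex_body[OF z0] this, of v]
  show ?thesis using v by (simp add: power2_norm_eq_inner[symmetric])
qed

text \<open>Positivity of the limit allows multiplicative comparison: for \<open>s < 1 < t\<close>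
  the offsets \<open>y k\<close> are eventually between \<open>s\<close> and \<open>t\<close> times
  \<open>z\<close>, and the scaling lemma used in both directions carries this over to support
  functions.\<close>

lemma support_fun_support_polytope_tendsto:
  fixes y :: "nat \<Rightarrow> 'i \<Rightarrow> real"
  assumes y: "\<And>k i. i \<in> I \<Longrightarrow> 0 < y k i" and z: "\<And>i. i \<in> I \<Longrightarrow> 0 < z i"
    and lim: "\<And>i. i \<in> I \<Longrightarrow> (\<lambda>k. y k i) \<longlonglongrightarrow> z i" and v: "v \<noteq> 0"
  shows "(\<lambda>k. support_fun (support_polytope u I (y k)) v) \<longlonglongrightarrow> support_fun (support_polytope u I z) v"
proof -
  let ?h = "support_fun (support_polytope u I z) v"
  let ?g = "\<lambda>k. support_fun (support_polytope u I (y k)) v"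
  have h: "0 < ?h" by (rule support_fun_pos[OF support_polytope_convex_body[OF z] v])
  have ev: "eventually (\<lambda>k. s * ?h \<le> ?g k \<and> ?g k \<le> t * ?h) sequentially" if st: "0 < s" "s < 1" "1 < t" for s t
  proof -
    have "eventually (\<lambda>k. \<forall>i\<in>I. s * z i < y k i \<and> y k i < t * z i) sequentially"
    proof (rule eventually_ball_finite[OF I], rule ballI)
      fix i assume i: "i \<in> I"
      have "s * z i < z i" "z i < t * z i" using st z[OF i] by auto
      then show "eventually (\<lambda>k. s * z i < y k i \<and> y k i < t * z i) sequentially"
        using lim[OF i] by (auto intro!: eventually_conj order_tendstoD)
    qed
    then show ?thesis
    proof eventually_elim
      case (elim k)
      have "?h \<le> (1 / s) * ?g k"
        by (rule support_fun_support_polytope_scale) (use z y elim st in \<open>auto simp: field_simps less_imp_le\<close>)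
      moreover have "?g k \<le> t * ?h"
        by (rule support_fun_support_polytope_scale) (use z y elim st in \<open>auto simp: less_imp_le\<close>)
      ultimately show ?case using st by (simp add: field_simps)
    qed
  qed
  show ?thesis
  proof (rule order_tendstoI)
    fix c assume c: "c < ?h"
    have "max (c / ?h) 0 < 1" using c h by simp
    then obtain s where "max (c / ?h) 0 < s" "s < 1" using dense by blast
    then have s: "0 < s" "s < 1" "c / ?h < s" by auto
    then have "c < s * ?h" using h by (simp add: field_simps)
    with ev[OF s(1,2), of 2] show "eventually (\<lambda>k. c < ?g k) sequentially"
      by (auto elim!: eventually_mono)
  next
    fix c assume c: "?h < c"
    have "1 < c / ?h" using c h by simp
    then obtain t where t: "1 < t" "t < c / ?h" using dense by blast
    then have "t * ?h < c" using h by (simp add: field_simps)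
    with ev[of "1/2" t] t show "eventually (\<lambda>k. ?g k < c) sequentially"
      by (auto elim!: eventually_mono)
  qed
qed

end

section \<open>Existence of minimisers\<close>

lemma finite_family_convergent_subseq:
  fixes y :: "nat \<Rightarrow> 'i \<Rightarrow> real"
  assumes "finite I" "\<And>k i. i \<in> I \<Longrightarrow> y k i \<in> {a..b}"
  obtains z s where "strict_mono s" "\<And>i. i \<in> I \<Longrightarrow> (\<lambda>k. y (s k) i) \<longlonglongrightarrow> z i"
proof -
  have "\<exists>s z. strict_mono s \<and> (\<forall>i\<in>I. (\<lambda>k. y (s k) i) \<longlonglongrightarrow> z i)"
    using assms
  proof (induction I)
    case empty
    show ?case using strict_mono_id by auto
  next
    case (insert j I)
    then obtain s z where s: "strict_mono s" "\<forall>i\<in>I. (\<lambda>k. y (s k) i) \<longlonglongrightarrow> z i" by blast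
    have "\<forall>k. y (s k) j \<in> {a..b}" using insert.prems by blast
    then obtain t l where t: "strict_mono t" "((\<lambda>k. y (s k) j) \<circ> t) \<longlonglongrightarrow> l"
      using compact_imp_seq_compact[OF compact_Icc[of a b]] unfolding seq_compact_def by metis
    have "(\<lambda>k. y (s (t k)) i) \<longlonglongrightarrow> (z(j := l)) i" if "i \<in> insert j I" for i
    proof (cases "i = j")
      case True then show ?thesis using t(2) by (simp add: comp_def)
    next
      case False
      then have "(\<lambda>k. y (s k) i) \<longlonglongrightarrow> z i" using s(2) that by blast
      from LIMSEQ_subseq_LIMSEQ[OF this t(1)] show ?thesis using False by (simp add: comp_def)
    qed
    moreover have "strict_mono (s \<circ> t)" by (rule strict_mono_o[OF s(1) t(1)])
    ultimately show ?case
      by (intro exI[of _ "s \<circ> t"] exI[of _ "z(j := l)"]) (simp add: comp_def)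
  qed
  then show ?thesis using that by blast
qed

text \<open>The threshold \<open>T\<close> is arbitrary so that the result also applies to
  \<open>G\<close> with rescaled first argument.\<close>

lemma B_tilde_minimizer:
  fixes G :: "real \<Rightarrow> 'a::euclidean_space \<Rightarrow> real" and u :: "'i \<Rightarrow> 'a"
  assumes dim: "DIM('a) \<ge> 2" and phi: "\<phi> \<in> class_I"
    and I: "finite I" and l: "\<And>i. i \<in> I \<Longrightarrow> 0 < l i"
    and unit: "u ` I \<subseteq> sphere 0 1" and spread: "not_in_closed_hemisphere (u ` I)"
    and G: "G \<in> class_G_I" and q: "q \<ge> real DIM('a) - 1" and c0: "c0 > 0"
    and growth: "\<And>t v. T \<le> t \<Longrightarrow> v \<in> sphere 0 1 \<Longrightarrow> c0 * t powr q \<le> G t v"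
  shows "\<exists>P \<in> B_tilde G. polytope P \<and> has_face_normals P (u ` I) \<and>
     (\<Sum>i\<in>I. l i * \<phi> (support_fun P (u i))) =
       (INF Q \<in> B_tilde G. \<Sum>i\<in>I. l i * \<phi> (support_fun Q (u i)))"
proof -
  have Ine: "I \<noteq> {}" by (rule index_nonempty[OF I unit spread])
  have phi_pos: "0 < \<phi> t" if "0 < t" for t using phi that by (simp add: class_I_def)
  have "strict_mono_on {0<..} \<phi>" using phi by (simp add: class_I_def)
  then have phi_less: "\<phi> s < \<phi> t" if "0 < s" "s < t" for s t
    using that by (intro strict_mono_onD[of "{0<..}" \<phi>]) auto
  have phi_le: "\<phi> s \<le> \<phi> t" if "0 < s" "s \<le> t" for s t
    using phi_less[of s t] that by (cases "s = t") auto
  have "continuous_on {0<..} \<phi>" using phi by (simp add: class_I_def)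
  then have phi_cont: "isCont \<phi> t" if "0 < t" for t
    using that by (simp add: continuous_on_eq_continuous_at)
  have phi_top: "filterlim \<phi> at_top at_top" using phi by (simp add: class_I_def)
  have u1: "norm (u i) = 1" if "i \<in> I" for i using unit that by auto

  define P where "P = support_polytope u I"
  define V where "V = dual_vol G (cball 0 1)"
  define F where "F = (\<lambda>z. \<integral>v. G (1 / support_fun (P z) v) v \<partial>spherical_measure)"
  define f where "f = (\<lambda>z. \<Sum>i\<in>I. l i * \<phi> (z i))"
  define D where "D = {z. (\<forall>i\<in>I. 0 < z i) \<and> F z \<le> V}"
  have P: "P z \<in> convex_bodies" if "\<And>i. i \<in> I \<Longrightarrow> 0 < z i" for z
    unfolding P_def by (rule support_polytope_convex_body[OF I unit spread that])

  have D_support: "(\<lambda>i. support_fun Q (u i)) \<in> D" if Q: "Q \<in> B_tilde G" for Q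
  proof -
    have Qc: "Q \<in> convex_bodies" and QV: "dual_vol G (polar_body Q) = V"
      using Q by (auto simp: B_tilde_def V_def)
    let ?z = "\<lambda>i. support_fun Q (u i)"
    have z: "0 < ?z i" if "i \<in> I" for i
      using u1[OF that] by (intro support_fun_pos[OF Qc]) auto
    have Pz: "P ?z \<in> convex_bodies" by (rule P[OF z])
    have "Q \<subseteq> P ?z" unfolding P_def support_polytope_def using inner_le_support_fun[OF Qc] by blast
    then have le: "support_fun Q v \<le> support_fun (P ?z) v" for v by (rule support_fun_mono[OF Qc Pz])
    have "F ?z \<le> (\<integral>v. G (1 / support_fun Q v) v \<partial>spherical_measure)" unfolding F_def
    proof (rule integral_radial_mono[OF G continuous_on_inverse_support_fun[OF Pz]
          continuous_on_inverse_support_fun[OF Qc] inverse_support_fun_pos[OF Pz]])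
      fix v :: 'a assume "v \<in> sphere 0 1"
      then have "0 < support_fun Q v" by (intro support_fun_pos[OF Qc]) auto
      with le[of v] show "1 / support_fun (P ?z) v \<le> 1 / support_fun Q v"
        by (intro divide_left_mono) auto
    qed
    also have "\<dots> = V" using QV dual_vol_polar_body[OF Qc, of G] by simp
    finally show ?thesis using z by (simp add: D_def)
  qed
  have "cball 0 1 \<in> B_tilde G" by (simp add: B_tilde_def cball_convex_body polar_body_cball)
  then have Dne: "D \<noteq> {}" using D_support by blast
  have f_nonneg: "0 \<le> f z" if "z \<in> D" for z
    unfolding f_def using that l phi_pos by (intro sum_nonneg mult_nonneg_nonneg) (auto simp: D_def less_imp_le)
  then have fbdd: "bdd_below (f ` D)" by (intro bdd_belowI[of _ 0]) auto
  define m where "m = Inf (f ` D)"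

  \<comment> \<open>The common lower bound \<open>a\<close> keeps the integrands dominated; without
    it the polar bodies could be unbounded along the sequence.\<close>
  have F_tendsto: "(\<lambda>k. F (y k)) \<longlonglongrightarrow> F z"
    if a: "0 < a" and y: "\<And>k i. i \<in> I \<Longrightarrow> a \<le> y k i"
      and z: "\<And>i. i \<in> I \<Longrightarrow> 0 < z i" and lim: "\<And>i. i \<in> I \<Longrightarrow> (\<lambda>k. y k i) \<longlonglongrightarrow> z i" for a y z
  proof -
    have y0: "0 < y k i" if "i \<in> I" for k i using y[OF that, of k] a by linarith
    have Py: "P (y k) \<in> convex_bodies" for k by (rule P[OF y0])
    have Pz: "P z \<in> convex_bodies" by (rule P[OF z])
    show ?thesis unfolding F_def
    proof (rule integral_radial_tendsto[OF G continuous_on_inverse_support_fun[OF Py]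
          inverse_support_fun_pos[OF Py] _ continuous_on_inverse_support_fun[OF Pz]
          inverse_support_fun_pos[OF Pz]])
      fix v :: 'a and k assume v: "v \<in> sphere 0 1"
      have "a \<le> support_fun (P (y k)) v" unfolding P_def
        by (rule support_fun_support_polytope_ge[OF I unit spread a y]) (use v in auto)
      then show "1 / support_fun (P (y k)) v \<le> 1 / a" using a by (intro divide_left_mono) auto
    next
      fix v :: 'a assume v: "v \<in> sphere 0 1"
      then have v0: "v \<noteq> 0" by auto
      have "(\<lambda>k. support_fun (P (y k)) v) \<longlonglongrightarrow> support_fun (P z) v" unfolding P_def
        by (rule support_fun_support_polytope_tendsto[OF I unit spread y0 z lim v0])
      then show "(\<lambda>k. 1 / support_fun (P (y k)) v) \<longlonglongrightarrow> 1 / support_fun (P z) v"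
        using support_fun_pos[OF Pz v0] by (intro tendsto_divide tendsto_const) auto
    qed
  qed
  have f_tendsto: "(\<lambda>k. f (y k)) \<longlonglongrightarrow> f z"
    if "\<And>i. i \<in> I \<Longrightarrow> 0 < z i" "\<And>i. i \<in> I \<Longrightarrow> (\<lambda>k. y k i) \<longlonglongrightarrow> z i" for y z
    unfolding f_def
    by (intro tendsto_sum tendsto_mult[OF tendsto_const])
       (rule isCont_tendsto_compose[OF phi_cont[OF that(1)] that(2)])

  \<comment> \<open>A single term \<open>l i * \<phi> (z i)\<close> is at most \<open>f z\<close>.
    The level \<open>m + 1\<close> is an arbitrary choice above the infimum under which the whole
    minimising sequence will lie.\<close>
  have "\<exists>R. \<forall>i\<in>I. \<forall>z\<in>D. f z \<le> m + 1 \<longrightarrow> z i \<le> R"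
  proof -
    have "\<exists>R. \<forall>z\<in>D. f z \<le> m + 1 \<longrightarrow> z i \<le> R" if i: "i \<in> I" for i
    proof -
      have "eventually (\<lambda>t. (m + 1) / l i < \<phi> t) at_top"
        using phi_top by (simp add: filterlim_at_top_dense)
      then obtain R where R: "\<And>t. R \<le> t \<Longrightarrow> (m + 1) / l i < \<phi> t" by (auto simp: eventually_at_top_linorder)
      show ?thesis
      proof (intro exI[of _ R] ballI impI)
        fix z assume z: "z \<in> D" "f z \<le> m + 1"
        have "l i * \<phi> (z i) \<le> f z" unfolding f_def
          by (rule member_le_sum[OF i]) (use l phi_pos z I in \<open>auto simp: D_def less_imp_le\<close>)
        then have "\<phi> (z i) \<le> (m + 1) / l i" using z l[OF i] by (simp add: field_simps)
        then show "z i \<le> R" using R[of "z i"] by (cases "z i \<le> R") auto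
      qed
    qed
    then have "\<forall>i\<in>I. \<exists>R. \<forall>z\<in>D. f z \<le> m + 1 \<longrightarrow> z i \<le> R" by blast
    from bchoice[OF this] obtain R where R: "\<forall>i\<in>I. \<forall>z\<in>D. f z \<le> m + 1 \<longrightarrow> z i \<le> R i" ..
    have "R i \<le> Max (R ` I)" if "i \<in> I" for i using I that by simp
    with R show ?thesis by (intro exI[of _ "Max (R ` I)"]) (blast intro: order_trans)
  qed
  then obtain R where R: "\<And>i z. i \<in> I \<Longrightarrow> z \<in> D \<Longrightarrow> f z \<le> m + 1 \<Longrightarrow> z i \<le> R" by blast

  have "\<exists>a>0. \<forall>i\<in>I. \<forall>z\<in>D. f z \<le> m + 1 \<longrightarrow> a \<le> z i"
  proof -
    obtain r where r: "r > 0" "\<And>x b. (\<And>i. i \<in> I \<Longrightarrow> x \<bullet> u i \<le> b) \<Longrightarrow> 0 \<le> b \<Longrightarrow> norm x \<le> r * b"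
      using norm_le_of_hemisphere[OF I spread] by metis
    \<comment> \<open>\<open>M\<close> bounds the norms in every \<open>P z\<close> with
      \<open>z\<close> below the level; taking \<open>max R 1\<close> ensures a nonnegative offset
      bound and \<open>M > 0\<close>.\<close>
    define M where "M = r * max R 1"
    have M: "M > 0" using r by (simp add: M_def)
    have "\<exists>a>0. \<forall>z\<in>D. f z \<le> m + 1 \<longrightarrow> a \<le> z i" if i: "i \<in> I" for i
    proof -
      obtain a where a: "a > 0" "\<And>r z. 0 < z \<Longrightarrow> z < a \<Longrightarrow> continuous_on (sphere 0 1) r \<Longrightarrow>
         (\<And>v. v \<in> sphere 0 1 \<Longrightarrow> 1 / (z + M * norm (v - u i)) \<le> r v) \<Longrightarrow>
         V < (\<integral>v. G (r v) v \<partial>spherical_measure)"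
        using integral_radial_spike_large[OF dim G c0 q growth u1[OF i] M, where V = V] by blast
      show ?thesis
      proof (intro exI[of _ a] conjI a(1) ballI impI, rule ccontr)
        fix z assume z: "z \<in> D" "f z \<le> m + 1" and less: "\<not> a \<le> z i"
        have z0: "0 < z j" if "j \<in> I" for j using z(1) that by (simp add: D_def)
        have Pz: "P z \<in> convex_bodies" by (rule P[OF z0])
        have "V < F z" unfolding F_def
        proof (rule a(2)[OF z0[OF i] _ continuous_on_inverse_support_fun[OF Pz]])
          show "z i < a" using less by simp
          fix v :: 'a assume v: "v \<in> sphere 0 1"
          then have "0 < support_fun (P z) v" by (intro support_fun_pos[OF Pz]) auto
          \<comment> \<open>The halfspace with normal \<open>u i\<close> controls the value at
            \<open>u i\<close>, and the norm bound controls the growth away from it; the reciprocal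
            is the spike.\<close>
          moreover have "support_fun (P z) v \<le> z i + M * norm (v - u i)"
          proof (rule support_fun_le[OF Pz])
            fix x assume x: "x \<in> P z"
            have xj: "x \<bullet> u j \<le> z j" if "j \<in> I" for j
              using x that by (auto simp: P_def support_polytope_def)
            have "norm x \<le> M" unfolding M_def
            proof (rule r(2))
              fix j assume j: "j \<in> I"
              show "x \<bullet> u j \<le> max R 1" using xj[OF j] R[OF j z] by linarith
            qed simp
            have "x \<bullet> v = x \<bullet> u i + x \<bullet> (v - u i)" by (simp add: inner_diff_right)
            also have "x \<bullet> (v - u i) \<le> norm x * norm (v - u i)" by (rule norm_cauchy_schwarz)
            also have "\<dots> \<le> M * norm (v - u i)" by (intro mult_right_mono \<open>norm x \<le> M\<close>) simp
            finally show "x \<bullet> v \<le> z i + M * norm (v - u i)" using xj[OF i] by linarith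
          qed
          ultimately show "1 / (z i + M * norm (v - u i)) \<le> 1 / support_fun (P z) v"
            by (intro divide_left_mono) auto
        qed
        then show False using z(1) by (simp add: D_def)
      qed
    qed
    then have "\<forall>i\<in>I. \<exists>a. a > 0 \<and> (\<forall>z\<in>D. f z \<le> m + 1 \<longrightarrow> a \<le> z i)" by blast
    from bchoice[OF this]
    obtain a where a: "\<forall>i\<in>I. a i > 0 \<and> (\<forall>z\<in>D. f z \<le> m + 1 \<longrightarrow> a i \<le> z i)" ..
    have "0 < Min (a ` I)" using I Ine a by simp
    moreover have "Min (a ` I) \<le> a i" if "i \<in> I" for i using I that by simp
    ultimately show ?thesis using a
      by (intro exI[of _ "Min (a ` I)"] conjI) (blast intro: order_trans)+
  qed
  then obtain a where a: "0 < a" "\<And>i z. i \<in> I \<Longrightarrow> z \<in> D \<Longrightarrow> f z \<le> m + 1 \<Longrightarrow> a \<le> z i" by blast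

  have "\<exists>z\<in>D. f z < m + 1 / real (Suc k)" for k
  proof -
    have "Inf (f ` D) < m + 1 / real (Suc k)" unfolding m_def by simp
    then show ?thesis using cInf_lessD[of "f ` D"] Dne by blast
  qed
  then obtain y where y: "\<And>k. y k \<in> D" "\<And>k. f (y k) < m + 1 / real (Suc k)" by metis
  have ym: "f (y k) \<le> m + 1" for k
  proof -
    have "1 / real (Suc k) \<le> 1" by simp
    then show ?thesis using y(2)[of k] by linarith
  qed
  have "y k i \<in> {a..R}" if "i \<in> I" for k i
    using a(2)[OF that y(1) ym] R[OF that y(1) ym] by simp
  from finite_family_convergent_subseq[of I y a R, OF I this]
  obtain z s where s: "strict_mono s" and z: "\<And>i. i \<in> I \<Longrightarrow> (\<lambda>k. y (s k) i) \<longlonglongrightarrow> z i" by blast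
  \<comment> \<open>Positivity alone could be lost in the limit; the uniform bound \<open>a\<close>
    is preserved.\<close>
  have za: "a \<le> z i" if "i \<in> I" for i
    by (rule LIMSEQ_le_const[OF z[OF that]]) (use a(2)[OF that y(1) ym] in auto)
  then have z0: "0 < z i" if "i \<in> I" for i using a(1) that by fastforce
  have Pz: "P z \<in> convex_bodies" by (rule P[OF z0])
  have "(\<lambda>k. F (y (s k))) \<longlonglongrightarrow> F z"
    by (rule F_tendsto[OF a(1) _ z0 z]) (rule a(2)[OF _ y(1) ym])
  then have FzV: "F z \<le> V"
    by (rule LIMSEQ_le_const2) (use y(1) in \<open>simp add: D_def\<close>)
  then have zD: "z \<in> D" using z0 by (simp add: D_def)
  have "f z \<le> m"
  proof (rule LIMSEQ_le[OF f_tendsto[OF z0 z]])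
    have "(\<lambda>k. m + 1 / real (Suc k)) \<longlonglongrightarrow> m + 0"
      by (intro tendsto_add tendsto_const LIMSEQ_Suc[OF lim_1_over_n])
    from LIMSEQ_subseq_LIMSEQ[OF this s] show "(\<lambda>k. m + 1 / real (Suc (s k))) \<longlonglongrightarrow> m"
      by (simp add: comp_def)
    show "\<exists>N. \<forall>n\<ge>N. f (y (s n)) \<le> m + 1 / real (Suc (s n))"
      by (intro exI[of _ 0] allI impI less_imp_le y(2))
  qed
  moreover have f_ge: "m \<le> f w" if "w \<in> D" for w
    unfolding m_def by (rule cINF_lower[OF fbdd that])
  ultimately have fz: "f z = m" using zD by (intro antisym)

  have "F z = V"
  proof (rule ccontr)
    assume "F z \<noteq> V"
    with FzV have less: "F z < V" by simp
    \<comment> \<open>The factor starts at \<open>1/2\<close>, since the denominator is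
      \<open>k + 2\<close>, so all \<open>w k\<close> stay above \<open>a / 2\<close> and
      \<open>F\<close> is continuous along them. For some \<open>k\<close> the constraint still
      holds, while every term of \<open>f\<close> has strictly decreased.\<close>
    define w where "w = (\<lambda>k i. (1 - 1 / real (Suc (Suc k))) * z i)"
    have half: "1/2 \<le> 1 - 1 / real (Suc (Suc k))" for k by (simp add: field_simps)
    have wlim: "(\<lambda>k. w k i) \<longlonglongrightarrow> z i" for i
    proof -
      have "(\<lambda>k. (1 - 1 / real (Suc (Suc k))) * z i) \<longlonglongrightarrow> (1 - 0) * z i"
        by (intro tendsto_mult tendsto_diff tendsto_const LIMSEQ_Suc[OF LIMSEQ_Suc[OF lim_1_over_n]])
      then show ?thesis by (simp add: w_def)
    qed
    have wa: "a / 2 \<le> w k i" if "i \<in> I" for k i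
    proof -
      have "1/2 * a \<le> w k i" unfolding w_def
        using half[of k] za[OF that] a(1) by (intro mult_mono) auto
      then show ?thesis by simp
    qed
    have "(\<lambda>k. F (w k)) \<longlonglongrightarrow> F z"
      by (rule F_tendsto[of "a / 2"]) (use a(1) wa z0 wlim in auto)
    then have "eventually (\<lambda>k. F (w k) < V) sequentially" using less by (rule order_tendstoD)
    then obtain k where "F (w k) < V" by (auto simp: eventually_sequentially)
    moreover have w0: "0 < w k i" if "i \<in> I" for i using wa[OF that, of k] a(1) by linarith
    ultimately have "w k \<in> D" by (simp add: D_def)
    then have "f z \<le> f (w k)" using f_ge fz by simp
    moreover have "f (w k) < f z" unfolding f_def
    proof (rule sum_strict_mono[OF I Ine])
      fix i assume i: "i \<in> I"
      have "w k i < z i" unfolding w_def using z0[OF i] by (simp add: field_simps)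
      then show "l i * \<phi> (w k i) < l i * \<phi> (z i)"
        using phi_less[OF w0[OF i]] l[OF i] by simp
    qed
    ultimately show False by simp
  qed
  then have PB: "P z \<in> B_tilde G"
    using dual_vol_polar_body[OF Pz, of G] Pz by (simp add: B_tilde_def F_def V_def)
  \<comment> \<open>The support numbers of \<open>P z\<close> may lie below \<open>z\<close>, which
    gives one inequality. They form an element of \<open>D\<close> themselves, as \<open>P z\<close>
    satisfies the original constraint, and minimality gives the other.\<close>
  have eq: "(\<Sum>i\<in>I. l i * \<phi> (support_fun (P z) (u i))) = m"
  proof (rule antisym)
    have "(\<Sum>i\<in>I. l i * \<phi> (support_fun (P z) (u i))) \<le> f z" unfolding f_def
    proof (intro sum_mono mult_left_mono phi_le)
      fix i assume i: "i \<in> I"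
      show "0 < support_fun (P z) (u i)" using u1[OF i] by (intro support_fun_pos[OF Pz]) auto
      show "support_fun (P z) (u i) \<le> z i"
        unfolding P_def by (rule support_fun_support_polytope_le[OF I unit spread z0 i])
      show "0 \<le> l i" using l[OF i] by simp
    qed
    then show "(\<Sum>i\<in>I. l i * \<phi> (support_fun (P z) (u i))) \<le> m" using fz by simp
    show "m \<le> (\<Sum>i\<in>I. l i * \<phi> (support_fun (P z) (u i)))"
      using f_ge[OF D_support[OF PB]] by (simp add: f_def)
  qed
  have lower: "m \<le> (\<Sum>i\<in>I. l i * \<phi> (support_fun Q (u i)))" if "Q \<in> B_tilde G" for Q
    using f_ge[OF D_support[OF that]] by (simp add: f_def)
  have "(INF Q \<in> B_tilde G. \<Sum>i\<in>I. l i * \<phi> (support_fun Q (u i))) = m"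
    by (rule cInf_eq_minimum) (use PB eq lower in \<open>auto intro: image_eqI[of _ _ "P z"]\<close>)
  then show ?thesis
    using PB eq support_polytope_polytope[OF I unit spread, of z]
      support_polytope_has_face_normals[OF I unit spread z0]
    unfolding P_def by auto
qed

section \<open>The homogeneous dual volume as a level of a dual volume\<close>

lemma measure_sphere_pos:
  assumes "DIM('a::euclidean_space) \<ge> 2"
  shows "0 < measure spherical_measure (sphere 0 1 :: 'a set)"
proof -
  interpret finite_measure "spherical_measure :: 'a measure" by (rule finite_measure_spherical_measure)
  obtain c where c: "c > 0" "\<And>(v::'a) s. norm v = 1 \<Longrightarrow> 0 < s \<Longrightarrow> s \<le> 1 \<Longrightarrow>
       c * s ^ (DIM('a) - 1) \<le> measure spherical_measure (sphere 0 1 \<inter> ball v s)"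
    using measure_spherical_cap_ge[OF assms] by metis
  obtain e :: 'a where e: "norm e = 1" using vector_choose_size[of 1] by auto
  have "c \<le> measure spherical_measure (sphere 0 1 \<inter> ball e 1)" using c(2)[OF e, of 1] by simp
  also have "\<dots> \<le> measure spherical_measure (sphere 0 1 :: 'a set)"
    by (rule finite_measure_mono) (auto simp: sets_spherical_measure sets_restrict_space)
  finally show ?thesis using c(1) by simp
qed

text \<open>As a function of the scale, the integral is continuous and strictly decreasing and
  passes through 1. The admissible scales therefore form a closed ray, whose left end is the only
  scale at which the integral equals 1.\<close>

lemma homogeneous_integral_level:
  fixes G :: "real \<Rightarrow> 'a::euclidean_space \<Rightarrow> real"
  assumes dim: "DIM('a) \<ge> 2" and G: "G \<in> class_G_I"
    and q: "q \<ge> real DIM('a) - 1" and c0: "c0 > 0"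
    and growth: "\<And>t v. T \<le> t \<Longrightarrow> v \<in> sphere 0 1 \<Longrightarrow> c0 * t powr q \<le> G t v"
    and r: "continuous_on (sphere 0 1) r" "\<And>v. v \<in> sphere 0 1 \<Longrightarrow> 0 < r v"
  shows "\<exists>\<eta>>0. Inf {\<eta>. \<eta> > 0 \<and> (\<integral>v. G (r v / \<eta>) v \<partial>spherical_measure) \<le> 1} = \<eta> \<and>
           (\<forall>\<eta>'>0. (\<integral>v. G (r v / \<eta>') v \<partial>spherical_measure) = 1 \<longleftrightarrow> \<eta>' = \<eta>)"
proof -
  let ?\<sigma> = "spherical_measure :: 'a measure"
  interpret finite_measure ?\<sigma> by (rule finite_measure_spherical_measure)
  define J where "J = (\<lambda>\<eta>. \<integral>v. G (r v / \<eta>) v \<partial>?\<sigma>)"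
  have \<sigma>: "0 < measure ?\<sigma> (sphere 0 1)" by (rule measure_sphere_pos[OF dim])
  have S: "compact (sphere (0::'a) 1)" "sphere (0::'a) 1 \<noteq> {}"
    using \<sigma> by (auto simp: measure_empty)
  have rc: "continuous_on (sphere 0 1) (\<lambda>v. r v / \<eta>)" if "0 < \<eta>" for \<eta>
    using that by (intro continuous_on_divide r continuous_on_const) auto
  have rp: "0 < r v / \<eta>" if "0 < \<eta>" "v \<in> sphere 0 1" for \<eta> v using r(2) that by simp
  have int: "integrable ?\<sigma> (\<lambda>v. G (r v / \<eta>) v)" if "0 < \<eta>" for \<eta>
    by (rule class_G_I_integrable_radial[OF G rc[OF that] rp[OF that]])
  obtain v1 where v1: "v1 \<in> sphere 0 1" "\<And>v. v \<in> sphere 0 1 \<Longrightarrow> r v1 \<le> r v"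
    using continuous_attains_inf[OF S r(1)] by blast
  obtain v2 where v2: "v2 \<in> sphere 0 1" "\<And>v. v \<in> sphere 0 1 \<Longrightarrow> r v \<le> r v2"
    using continuous_attains_sup[OF S r(1)] by blast

  have J_anti: "J \<eta>' < J \<eta>" if \<eta>: "0 < \<eta>" "\<eta> < \<eta>'" for \<eta> \<eta>'
    unfolding J_def
  proof (rule integral_less_AE_space)
    show "integrable ?\<sigma> (\<lambda>v. G (r v / \<eta>') v)" "integrable ?\<sigma> (\<lambda>v. G (r v / \<eta>) v)"
      using \<eta> by (intro int; simp)+
    show "emeasure ?\<sigma> (space ?\<sigma>) \<noteq> 0" using \<sigma> by (simp add: emeasure_eq_measure)
    show "AE v in ?\<sigma>. G (r v / \<eta>') v < G (r v / \<eta>) v"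
    proof (rule AE_I2)
      fix v assume "v \<in> space ?\<sigma>"
      then have v: "v \<in> sphere 0 1" by simp
      have "r v / \<eta>' < r v / \<eta>" using r(2)[OF v] \<eta> by (intro divide_strict_left_mono) auto
      moreover have "0 < r v / \<eta>'" using rp[OF _ v] \<eta> by simp
      ultimately show "G (r v / \<eta>') v < G (r v / \<eta>) v" by (intro class_G_I_strict_mono[OF G _ _ v])
    qed
  qed

  have J_cont: "continuous_on {a..b} J" if a: "0 < a" for a b
  proof (rule continuous_on_sequentiallyI)
    fix y x assume y: "\<forall>n. y n \<in> {a..b}" and x: "x \<in> {a..b}" and lim: "y \<longlonglongrightarrow> x"
    have y0: "0 < y k" for k using y a by (meson atLeastAtMost_iff less_le_trans)
    have x0: "0 < x" using x a by simp
    show "(\<lambda>n. J (y n)) \<longlonglongrightarrow> J x" unfolding J_def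
    proof (rule integral_radial_tendsto[OF G rc[OF y0] rp[OF y0] _ rc[OF x0] rp[OF x0]])
      fix v :: 'a and k assume v: "v \<in> sphere 0 1"
      have "a \<le> y k" using y by simp
      with a v2(2)[OF v] r(2)[OF v2(1)] y0[of k] show "r v / y k \<le> r v2 / a"
        by (intro frac_le) auto
    next
      fix v :: 'a assume v: "v \<in> sphere 0 1"
      show "(\<lambda>k. r v / y k) \<longlonglongrightarrow> r v / x" using x0 by (intro tendsto_divide tendsto_const lim) simp
    qed
  qed

  obtain a where a: "0 < a" "1 \<le> J a"
  proof -
    \<comment> \<open>The three entries make the growth bound applicable, give
      \<open>t \<le> t powr q\<close> (as \<open>q \<ge> 1\<close>), and make the constant
      \<open>c0 * t\<close> integrate to at least 1. At scale \<open>r v1 / t\<close>, with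
      \<open>r v1\<close> the minimum of \<open>r\<close>, every argument of \<open>G\<close> is at
      least \<open>t\<close>.\<close>
    define t where "t = max (max T 1) (1 / (c0 * measure ?\<sigma> (sphere 0 1)))"
    have t: "T \<le> t" "1 \<le> t" "1 / (c0 * measure ?\<sigma> (sphere 0 1)) \<le> t" by (auto simp: t_def)
    have t1: "1 \<le> c0 * t * measure ?\<sigma> (sphere 0 1)"
      using t(3) c0 \<sigma> by (simp add: field_simps)
    let ?a = "r v1 / t"
    have a0: "0 < ?a" using r(2)[OF v1(1)] t by simp
    have "c0 * t * measure ?\<sigma> (sphere 0 1) = (\<integral>v. c0 * t \<partial>?\<sigma>)" by simp
    also have "\<dots> \<le> J ?a" unfolding J_def
    proof (rule integral_mono[OF _ int[OF a0]])
      fix v assume "v \<in> space ?\<sigma>"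
      then have v: "v \<in> sphere 0 1" by simp
      have "t * r v1 \<le> t * r v" using v1(2)[OF v] t by (intro mult_left_mono) auto
      then have le: "t \<le> r v / ?a" using r(2)[OF v1(1)] t by (simp add: field_simps)
      have "t = t powr 1" using t by simp
      also have "\<dots> \<le> t powr q" using t q dim by (intro powr_mono) auto
      finally have "c0 * t \<le> c0 * t powr q" using c0 by simp
      also have "\<dots> \<le> G t v" by (rule growth[OF t(1) v])
      also have "\<dots> \<le> G (r v / ?a) v" by (rule class_G_I_mono[OF G _ le v]) (use t in simp)
      finally show "c0 * t \<le> G (r v / ?a) v" .
    qed simp
    finally show ?thesis using that[OF a0] t1 by simp
  qed

  obtain b where b: "a \<le> b" "J b \<le> 1"
  proof -
    \<comment> \<open>Along the scales \<open>Suc k\<close> the arguments of \<open>G\<close> tend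
      to 0 pointwise, and the integrand at scale 1 is a majorant.\<close>
    have "(\<lambda>k. J (real (Suc k))) \<longlonglongrightarrow> (\<integral>v. 0 \<partial>?\<sigma>)" unfolding J_def
    proof (rule integral_dominated_convergence[where w = "\<lambda>v. G (r v / 1) v"])
      show "integrable ?\<sigma> (\<lambda>v. G (r v / 1) v)" by (rule int) simp
      show "(\<lambda>v. G (r v / real (Suc k)) v) \<in> borel_measurable ?\<sigma>" for k
        by (rule borel_measurable_integrable[OF int]) simp
      show "AE v in ?\<sigma>. norm (G (r v / real (Suc k)) v) \<le> G (r v / 1) v" for k
      proof (rule AE_I2)
        fix v assume "v \<in> space ?\<sigma>"
        then have v: "v \<in> sphere 0 1" by simp
        have p: "0 < r v / real (Suc k)" by (rule rp[OF _ v]) simp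
        have "r v / real (Suc k) \<le> r v / 1" using r(2)[OF v] by (intro divide_left_mono) auto
        from class_G_I_mono[OF G p this v] class_G_I_pos[OF G p v]
        show "norm (G (r v / real (Suc k)) v) \<le> G (r v / 1) v" by simp
      qed
      show "AE v in ?\<sigma>. (\<lambda>k. G (r v / real (Suc k)) v) \<longlonglongrightarrow> 0"
      proof (rule AE_I2)
        fix v assume "v \<in> space ?\<sigma>"
        then have v: "v \<in> sphere 0 1" by simp
        have "(\<lambda>k. r v * (1 / real (Suc k))) \<longlonglongrightarrow> r v * 0"
          by (intro tendsto_mult tendsto_const LIMSEQ_Suc[OF lim_1_over_n])
        moreover have "0 < r v / real (Suc k)" for k by (rule rp[OF _ v]) simp
        ultimately have "filterlim (\<lambda>k. r v / real (Suc k)) (at_right 0) sequentially"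
          by (auto simp: filterlim_at less_imp_neq[symmetric])
        moreover have "((\<lambda>t. G t v) \<longlongrightarrow> 0) (at_right 0)" using G v by (simp add: class_G_I_def)
        ultimately show "(\<lambda>k. G (r v / real (Suc k)) v) \<longlonglongrightarrow> 0"
          by (rule filterlim_compose[rotated])
      qed
    qed simp
    then have "(\<lambda>k. J (real (Suc k))) \<longlonglongrightarrow> 0" by simp
    then have "eventually (\<lambda>k. J (real (Suc k)) < 1) sequentially" by (rule order_tendstoD) simp
    moreover have "eventually (\<lambda>k. a \<le> real (Suc k)) sequentially"
      using eventually_ge_at_top[of "nat \<lceil>a\<rceil>"] by eventually_elim linarith
    ultimately have "eventually (\<lambda>k. a \<le> real (Suc k) \<and> J (real (Suc k)) < 1) sequentially"
      by eventually_elim simp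
    then obtain k where "a \<le> real (Suc k)" "J (real (Suc k)) < 1" by (auto simp: eventually_sequentially)
    then show ?thesis using that[of "real (Suc k)"] by simp
  qed

  obtain \<eta> where \<eta>: "a \<le> \<eta>" "J \<eta> = 1"
    using IVT2'[OF b(2) a(2) b(1) J_cont[OF a(1)]] by blast
  have \<eta>0: "0 < \<eta>" using a \<eta> by simp
  have "{\<eta>'. \<eta>' > 0 \<and> J \<eta>' \<le> 1} = {\<eta>..}"
  proof (intro equalityI subsetI)
    fix t assume "t \<in> {\<eta>'. \<eta>' > 0 \<and> J \<eta>' \<le> 1}"
    then show "t \<in> {\<eta>..}" using J_anti[of t \<eta>] \<eta> by (cases "t < \<eta>") auto
  next
    fix t assume "t \<in> {\<eta>..}"
    then show "t \<in> {\<eta>'. \<eta>' > 0 \<and> J \<eta>' \<le> 1}" using J_anti[of \<eta> t] \<eta> \<eta>0 by (cases "t = \<eta>") auto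
  qed
  then have "Inf {\<eta>'. \<eta>' > 0 \<and> J \<eta>' \<le> 1} = \<eta>" by simp
  moreover have "J \<eta>' = 1 \<longleftrightarrow> \<eta>' = \<eta>" if "0 < \<eta>'" for \<eta>'
    using J_anti[of \<eta> \<eta>'] J_anti[of \<eta>' \<eta>] that \<eta> \<eta>0 by (cases \<eta> \<eta>' rule: linorder_cases) auto
  ultimately show ?thesis using \<eta>0 unfolding J_def by blast
qed

lemma class_G_I_rescale:
  assumes G: "G \<in> class_G_I" and c: "0 < (c::real)"
  shows "(\<lambda>t v. G (t / c) v) \<in> class_G_I"
  unfolding class_G_I_def
proof (intro CollectI conjI allI ballI impI)
  have "continuous_on ({0<..} \<times> sphere 0 1) (\<lambda>(t, u). G t u)" using G by (simp add: class_G_I_def)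
  then have "continuous_on ({0<..} \<times> sphere 0 1) (\<lambda>x. case (fst x / c, snd x) of (t, u) \<Rightarrow> G t u)"
    by (rule continuous_on_compose2) (use c in \<open>auto intro!: continuous_intros\<close>)
  then show "continuous_on ({0<..} \<times> sphere 0 1) (\<lambda>(t, u). G (t / c) u)"
    by (simp add: case_prod_unfold)
next
  fix t :: real and v :: 'a assume "0 < t" "v \<in> sphere 0 1"
  then show "0 < G (t / c) v" using c by (intro class_G_I_pos[OF G]) auto
next
  fix v :: 'a assume v: "v \<in> sphere 0 1"
  show "strict_mono_on {0<..} (\<lambda>t. G (t / c) v)"
  proof (rule strict_mono_onI)
    fix s t :: real assume "s \<in> {0<..}" "t \<in> {0<..}" "s < t"
    then show "G (s / c) v < G (t / c) v"
      using c by (intro class_G_I_strict_mono[OF G _ _ v]) (auto intro: divide_strict_right_mono)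
  qed
  have "((\<lambda>t. t / c) \<longlongrightarrow> 0 / c) (at_right 0)" using c by (intro tendsto_divide tendsto_ident_at tendsto_const) auto
  moreover have "eventually (\<lambda>t. t / c \<in> {0<..} \<and> t / c \<noteq> 0) (at_right 0)"
    using c by (auto simp: eventually_at_right_less eventually_at_right[of 0 1])
  ultimately have "filterlim (\<lambda>t. t / c) (at_right 0) (at_right 0)" by (simp add: filterlim_at)
  moreover have "((\<lambda>t. G t v) \<longlongrightarrow> 0) (at_right 0)" using G v by (simp add: class_G_I_def)
  ultimately show "((\<lambda>t. G (t / c) v) \<longlongrightarrow> 0) (at_right 0)" by (rule filterlim_compose[rotated])
  have "filterlim (\<lambda>t. (1 / c) * t) at_top at_top"
    using c by (intro filterlim_tendsto_pos_mult_at_top[OF tendsto_const _ filterlim_ident]) auto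
  then have "filterlim (\<lambda>t. t / c) at_top at_top" by simp
  moreover have "filterlim (\<lambda>t. G t v) at_top at_top" using G v by (simp add: class_G_I_def)
  ultimately show "filterlim (\<lambda>t. G (t / c) v) at_top at_top" by (rule filterlim_compose[rotated])
qed

lemma hom_dual_vol_polar_body:
  assumes "K \<in> convex_bodies"
  shows "hom_dual_vol G (polar_body K) =
    Inf {\<eta>. \<eta> > 0 \<and> (\<integral>v. G (1 / support_fun K v / \<eta>) v \<partial>spherical_measure) \<le> 1}"
proof -
  have "(\<integral>v. G (radial_fun (polar_body K) v / \<eta>) v \<partial>spherical_measure) =
        (\<integral>v. G (1 / support_fun K v / \<eta>) v \<partial>spherical_measure)" for \<eta>
    using dual_vol_polar_body[OF assms, of "\<lambda>t v. G (t / \<eta>) v"] by (simp add: dual_vol_def)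
  then show ?thesis by (simp add: hom_dual_vol_def)
qed

text \<open>With \<open>c\<close> the homogeneous dual volume of the ball, a polar has homogeneous
  dual volume \<open>c\<close> exactly if its dual volume for the rescaled function is 1. The ball,
  being its own polar, also attains this value 1, so the two constraints coincide.\<close>

lemma B_hat_eq_B_tilde:
  fixes G :: "real \<Rightarrow> 'a::euclidean_space \<Rightarrow> real"
  assumes dim: "DIM('a) \<ge> 2" and G: "G \<in> class_G_I"
    and q: "q \<ge> real DIM('a) - 1" and c0: "c0 > 0"
    and growth: "\<And>t v. T \<le> t \<Longrightarrow> v \<in> sphere 0 1 \<Longrightarrow> c0 * t powr q \<le> G t v"
  obtains c where "c > 0" "B_hat G = B_tilde (\<lambda>t v. G (t / c) v)"
proof -
  define c where "c = hom_dual_vol G (cball 0 1)"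
  have level: "\<exists>\<eta>>0. hom_dual_vol G (polar_body K) = \<eta> \<and>
      (\<forall>\<eta>'>0. dual_vol (\<lambda>t v. G (t / \<eta>') v) (polar_body K) = 1 \<longleftrightarrow> \<eta>' = \<eta>)"
    if K: "K \<in> convex_bodies" for K :: "'a set"
    unfolding hom_dual_vol_polar_body[OF K] dual_vol_polar_body[OF K]
    by (rule homogeneous_integral_level[OF dim G q c0 growth continuous_on_inverse_support_fun[OF K]
          inverse_support_fun_pos[OF K]])
  have c: "c > 0" and ball: "dual_vol (\<lambda>t v. G (t / c) v) (cball 0 1) = 1"
    using level[OF cball_convex_body] by (auto simp: polar_body_cball c_def)
  have "hom_dual_vol G (polar_body Q) = c \<longleftrightarrow> dual_vol (\<lambda>t v. G (t / c) v) (polar_body Q) = 1"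
    if "Q \<in> convex_bodies" for Q :: "'a set"
    using level[OF that] c by metis
  then have "B_hat G = B_tilde (\<lambda>t v. G (t / c) v)"
    unfolding B_hat_def B_tilde_def ball c_def[symmetric] by blast
  with c that show ?thesis by blast
qed

theorem theorem4p3:
  fixes \<phi> :: "real \<Rightarrow> real"
    and G :: "real \<Rightarrow> real ^ 'n \<Rightarrow> real"
    and m :: nat
    and l :: "nat \<Rightarrow> real"
    and u :: "nat \<Rightarrow> real ^ 'n"
    and q :: real
  assumes dim: "CARD('n) \<ge> 2"
    and phi: "\<phi> \<in> class_I"
    and weights: "\<And>i. i \<in> {1..m} \<Longrightarrow> l i > 0"
    and unit: "u ` {1..m} \<subseteq> sphere 0 1"
    and spread: "not_in_closed_hemisphere (u ` {1..m})"
    and G: "G \<in> class_G_I"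
    and q: "q \<ge> real CARD('n) - 1"
    and growth: "(INF (t, v) \<in> {1..} \<times> sphere 0 1. G t v / t powr q) > 0"
  shows "(\<exists>P \<in> B_tilde G. polytope P \<and> has_face_normals P (u ` {1..m}) \<and>
            (\<Sum>i=1..m. l i * \<phi> (support_fun P (u i))) =
              (INF Q \<in> B_tilde G. \<Sum>i=1..m. l i * \<phi> (support_fun Q (u i)))) \<and>
         (\<exists>P \<in> B_hat G. polytope P \<and> has_face_normals P (u ` {1..m}) \<and>
            (\<Sum>i=1..m. l i * \<phi> (support_fun P (u i))) =
              (INF Q \<in> B_hat G. \<Sum>i=1..m. l i * \<phi> (support_fun Q (u i))))"
proof -
  have dim': "DIM(real ^ 'n) \<ge> 2" and q': "q \<ge> real DIM(real ^ 'n) - 1" using dim q by auto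
  define c0 where "c0 = (INF (t, v) \<in> {1..} \<times> sphere 0 1. G t v / t powr q)"
  have c0: "c0 > 0" using growth by (simp add: c0_def)
  have low: "c0 * t powr q \<le> G t v" if t: "1 \<le> t" and v: "v \<in> sphere 0 1" for t v
  proof -
    \<comment> \<open>A real infimum is a lower bound only of a set that is bounded below;
      positivity of \<open>G\<close> supplies the bound 0.\<close>
    have "bdd_below ((\<lambda>(t, v). G t v / t powr q) ` ({1..} \<times> sphere 0 1))"
    proof (rule bdd_belowI2[of _ 0])
      fix x :: "real \<times> (real ^ 'n)" assume "x \<in> {1..} \<times> sphere 0 1"
      then show "0 \<le> (case x of (t, v) \<Rightarrow> G t v / t powr q)"
        using class_G_I_pos[OF G, of "fst x" "snd x"] by (auto simp: case_prod_unfold less_imp_le)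
    qed
    from cINF_lower[OF this, of "(t, v)"] t v have "c0 \<le> G t v / t powr q" by (simp add: c0_def)
    moreover have "0 < t powr q" using t by simp
    ultimately show ?thesis by (simp add: pos_le_divide_eq)
  qed
  obtain c where c: "c > 0" "B_hat G = B_tilde (\<lambda>t v. G (t / c) v)"
    using B_hat_eq_B_tilde[OF dim' G q' c0 low] by blast
  \<comment> \<open>Rescaling by \<open>c\<close> preserves the growth exponent, changes the
    constant to \<open>c0 / c powr q\<close> and moves the threshold from 1 to
    \<open>c\<close>.\<close>
  have low': "c0 / c powr q * t powr q \<le> G (t / c) v" if t: "c \<le> t" and v: "v \<in> sphere 0 1" for t v
  proof -
    have "c0 * (t / c) powr q \<le> G (t / c) v" using c t by (intro low v) simp
    then show ?thesis using c t by (simp add: powr_divide)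
  qed
  show ?thesis unfolding c(2)
    using B_tilde_minimizer[where I = "{1..m}", OF dim' phi _ weights unit spread G q' c0 low]
      B_tilde_minimizer[where I = "{1..m}", OF dim' phi _ weights unit spread class_G_I_rescale[OF G c(1)] q' _ low'] c0 c(1)
    by simp
qed

end
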